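(* Consider the dual risk model with proportionality parameter uniformly distributed on $[a,b]$, $0<a<b$, described in the context, with ruin probability $R(x)$ and Laplace transform $\rho(s)=\int_0^\infty e^{-sx}R(x)\,dx$. Put $$k(s,v)=\frac{\phi(s)}{b-a}\,\frac{\mu}{\mu(1+v)-s},\qquad L(s)=\frac{1-\phi(s)}{s}-\frac{\phi(s)}{b-a}\,\rho(\mu)\ln\Big(\frac{(1+b)\mu-s}{(1+a)\mu-s}\Big).$$ Provided that $\ln\big(\frac{b+1}{a+1}\big)<1$, or equivalently $\frac{b+1}{a+1}<e$, $$\rho(s)=L(s)+\sum_{j=1}^{\infty}\int\!\cdots\!\int_{[a,b]^{j}}\ \prod_{i=1}^{j}k\Big(\frac{s}{\prod_{m=1}^{i-1}(1+v_m)},v_i\Big)\,L\Big(\frac{s}{\prod_{m=1}^{j}(1+v_m)}\Big)\,dv_1\cdots dv_j,$$ with empty products equal to $1$, and $$\rho(\mu)=\frac{\displaystyle\sum_{j=0}^{\infty}\int\!\cdots\!\int_{[a,b]^{j}}\prod_{i=1}^{j}k\Big(\frac{\mu}{\prod_{m=1}^{i-1}(1+v_m)},v_i\Big)\,\frac{1-\phi(\mu/\pi_j)}{\mu/\pi_j}\,dv_1\cdots dv_j}{\displaystyle 1+\frac{1}{b-a}\sum_{j=0}^{\infty}\int\!\cdots\!\int_{[a,b]^{j}}\prod_{i=1}^{j}k\Big(\frac{\mu}{\prod_{m=1}^{i-1}(1+v_m)},v_i\Big)\,\phi(\mu/\pi_j)\,\ln\Big(\frac{(1+b)\pi_j-1}{(1+a)\pi_j-1}\Big)\,dv_1\cdots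 dv_j},$$ where $\pi_j=\prod_{m=1}^{j}(1+v_m)$ and the $j=0$ term is the integrand with $\pi_0=1$ (no integration).
   Context: Model. The surplus process is $U(t)=x-t+\sum_{i=1}^{N(t)}(C_i+V_iU(S_i^-))$, $t\ge 0$, with $U(0)=x>0$, where $N(t)$ is the number of gains arriving in $(0,t]$, $S_i$ is the arrival time of the $i$-th gain, the gain interarrival times are i.i.d. with c.d.f. $B(\cdot)$, a density, and Laplace–Stieltjes transform $\phi(\cdot)$, the gain sizes $C_i$ are i.i.d. exponential with rate $\mu$, and $V_1,V_2,\dots$ are i.i.d. uniform on $[a,b]$; these sequences are independent of each other. Ruin occurs when $U$ hits $0$, and $R(x)$ is the probability that ruin ever occurs starting from $x$. Thus $$R(x)=1-B(x)+\int_{v=a}^{b}\int_{t=0}^{x}\int_{y=0}^{\infty}R((1+v)(x-t)+y)\,\mu e^{-\mu y}\,dy\,dB(t)\,\frac{dv}{b-a}.$$ *)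

theory Defs
  imports "HOL-Probability.Probability"
begin

(* Sequences of random variables are indexed from 0: T i, C i, V i belong to the (i+1)-st gain. *)

definition arrival_time :: "(nat \<Rightarrow> 'a \<Rightarrow> real) \<Rightarrow> 'a \<Rightarrow> nat \<Rightarrow> real" where
  "arrival_time T \<omega> i = (\<Sum>l\<le>i. T l \<omega>)"

definition num_gains :: "(nat \<Rightarrow> 'a \<Rightarrow> real) \<Rightarrow> 'a \<Rightarrow> real \<Rightarrow> nat" where
  "num_gains T \<omega> t = card {i. 0 < arrival_time T \<omega> i \<and> arrival_time T \<omega> i \<le> t}"

(* The level U(S_i^-) just before a gain: the gains that have already arrived are those with
   smaller index, so the equation that determines U gives this recursion. *)
fun pre_gain_level ::
  "(nat \<Rightarrow> 'a \<Rightarrow> real) \<Rightarrow> (nat \<Rightarrow> 'a \<Rightarrow> real) \<Rightarrow> (nat \<Rightarrow> 'a \<Rightarrow> real) \<Rightarrow> real \<Rightarrow> 'a \<Rightarrow> nat \<Rightarrow> real" where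
  "pre_gain_level T C V x \<omega> i =
     x - arrival_time T \<omega> i + (\<Sum>l<i. C l \<omega> + V l \<omega> * pre_gain_level T C V x \<omega> l)"

declare pre_gain_level.simps [simp del]

definition surplus ::
  "(nat \<Rightarrow> 'a \<Rightarrow> real) \<Rightarrow> (nat \<Rightarrow> 'a \<Rightarrow> real) \<Rightarrow> (nat \<Rightarrow> 'a \<Rightarrow> real) \<Rightarrow> real \<Rightarrow> 'a \<Rightarrow> real \<Rightarrow> real" where
  "surplus T C V x \<omega> t =
     x - t + (\<Sum>i<num_gains T \<omega> t. C i \<omega> + V i \<omega> * pre_gain_level T C V x \<omega> i)"

definition ruin_prob ::
  "'a measure \<Rightarrow> (nat \<Rightarrow> 'a \<Rightarrow> real) \<Rightarrow> (nat \<Rightarrow> 'a \<Rightarrow> real) \<Rightarrow> (nat \<Rightarrow> 'a \<Rightarrow> real) \<Rightarrow> real \<Rightarrow> real" where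
  "ruin_prob M T C V x = measure M {\<omega> \<in> space M. \<exists>t\<ge>0. surplus T C V x \<omega> t = 0}"

(* The interarrival c.d.f. B enters through its density f. *)
locale dual_risk_model = prob_space M for M :: "'a measure" +
  fixes T C V :: "nat \<Rightarrow> 'a \<Rightarrow> real"
    and f :: "real \<Rightarrow> real" and \<mu> a b :: real
  assumes mu_pos: "0 < \<mu>"
    and a_pos: "0 < a" and a_less_b: "a < b"
    and density_nonneg: "\<And>t. 0 \<le> f t"
    and density_support: "\<And>t. t < 0 \<Longrightarrow> f t = 0"
    and interarrival: "\<And>i. distributed M lborel (T i) f"
    and gain: "\<And>i. distributed M lborel (C i) (exponential_density \<mu>)"
    and proportion: "\<And>i. distributed M lborel (V i) (\<lambda>v. indicator {a..b} v / (b - a))"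
    and independent:
      "indep_vars (\<lambda>_. borel) (case_sum T (case_sum C V)) (UNIV :: (nat + nat + nat) set)"

definition laplace_stieltjes :: "real measure \<Rightarrow> complex \<Rightarrow> complex" where
  "laplace_stieltjes D s = (LINT t|D. exp (- (s * of_real t)))"

definition laplace_transform :: "(real \<Rightarrow> real) \<Rightarrow> complex \<Rightarrow> complex" where
  "laplace_transform R s = (LBINT x:{0..}. exp (- (s * of_real x)) * of_real (R x))"

definition kernel_k :: "(complex \<Rightarrow> complex) \<Rightarrow> real \<Rightarrow> real \<Rightarrow> real \<Rightarrow> complex \<Rightarrow> real \<Rightarrow> complex" where
  "kernel_k \<phi> \<mu> a b s v =
     \<phi> s / of_real (b - a) * (of_real \<mu> / (of_real (\<mu> * (1 + v)) - s))"

definition source_L ::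
  "(complex \<Rightarrow> complex) \<Rightarrow> (complex \<Rightarrow> complex) \<Rightarrow> real \<Rightarrow> real \<Rightarrow> real \<Rightarrow> complex \<Rightarrow> complex" where
  "source_L \<phi> \<rho> \<mu> a b s =
     (1 - \<phi> s) / s
     - \<phi> s / of_real (b - a) * \<rho> (of_real \<mu>)
       * ln ((of_real ((1 + b) * \<mu>) - s) / (of_real ((1 + a) * \<mu>) - s))"

definition growth :: "nat \<Rightarrow> (nat \<Rightarrow> real) \<Rightarrow> real" where
  "growth j v = (\<Prod>m\<in>{1..j}. 1 + v m)"

definition kernel_prod ::
  "(complex \<Rightarrow> complex) \<Rightarrow> real \<Rightarrow> real \<Rightarrow> real \<Rightarrow> complex \<Rightarrow> nat \<Rightarrow> (nat \<Rightarrow> real) \<Rightarrow> complex" where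
  "kernel_prod \<phi> \<mu> a b s j v =
     (\<Prod>i\<in>{1..j}. kernel_k \<phi> \<mu> a b (s / of_real (growth (i - 1) v)) (v i))"

(* Lebesgue integration over the cube [a,b]^j; for j = 0 the product space is a single point
   of mass 1, so the integral is the value of the integrand there. *)
definition cube_integrable :: "real \<Rightarrow> real \<Rightarrow> nat \<Rightarrow> ((nat \<Rightarrow> real) \<Rightarrow> complex) \<Rightarrow> bool" where
  "cube_integrable a b j g \<longleftrightarrow>
     set_integrable (Pi\<^sub>M {1..j} (\<lambda>_. lborel)) ({1..j} \<rightarrow>\<^sub>E {a..b}) g"

definition cube_integral :: "real \<Rightarrow> real \<Rightarrow> nat \<Rightarrow> ((nat \<Rightarrow> real) \<Rightarrow> complex) \<Rightarrow> complex" where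
  "cube_integral a b j g =
     (LINT v:({1..j} \<rightarrow>\<^sub>E {a..b})|Pi\<^sub>M {1..j} (\<lambda>_. lborel). g v)"

(* No denominator mu (1 + v_i) - s / ((1 + v_1) ... (1 + v_(i-1))) in the formulas vanishes on
   the closed cube. In particular no logarithm is evaluated at 0, at infinity or on its cut. *)
definition pole_free :: "real \<Rightarrow> real \<Rightarrow> real \<Rightarrow> complex \<Rightarrow> bool" where
  "pole_free \<mu> a b s \<longleftrightarrow>
     (\<forall>j\<ge>1. \<forall>v\<in>{1..j} \<rightarrow> {a..b}. s \<noteq> of_real (\<mu> * growth j v))"

end

(* Let pi_j = (1 + v_1) ... (1 + v_j). Conditioning on the first gain gives an integral equation for R
   whose Laplace transform is rho(s) = L(s) + int k(s,v) rho(s/(1+v)) dv. Iterating it n times leaves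
   the remainder int K_n rho(s/pi_n), which up to a bounded factor is at most the mean of
   phi(sigma) phi(sigma/pi_1) ... phi(sigma/pi_{n-1}) r(sigma/pi_n) over independent uniform v_i,
   where sigma = Re s and r(x) = x rho(x) lies in [0,1]. No moment of the interarrival time is assumed,
   so r(0+) = 0 may fail. Let D(x) be the mean of the infinite product phi(x) phi(x/pi_1) ... . An induction over
   the gains shows R(x) <= 1 - D(t) + exp(-t x) for all t > 0, and a zero-one argument shows that either
   D = 0, so that the product itself kills the remainder, or sup D = 1, so that r is small near 0.
   The formula for rho(mu) is the series at s = mu solved for rho(mu). *)

theory Submission
  imports Defs
begin

section \<open>Ruin as a failure of survival in the embedded chain\<close>

text \<open>The proof follows the levels just after the gains and their survival probability:
  survival obeys a recursion without an inhomogeneous term, and ruin reenters through the transform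
  1 / s of the constant 1. The bounded factor in the remainder comes from weighting each kernel by 1
  + v. As rho(s/pi_n) may be of size pi_n / sigma, weights with product pi_n are needed anyway, and
  mu (1 + v) / |mu (1 + v) - z| is at most 1 + |z| / delta. For z = s / pi_i this excess is of order
  (1 + a)^(-i), so the product over i stays bounded if delta bounds the distance to the poles
  uniformly in i. \<open>pole_free\<close> only says that nothing vanishes, so delta requires
  compactness. D(t) is the limit of E exp(-t A_n), where A_n is the sum of T_i / pi_i over i < n,
  the interarrival times discounted by the growth factors. Gain sizes only help, so failure within n
  gains forces A_n > x; then exp(-t A_n) is at most the survival indicator plus exp(-t x), which is
  the bound on R.\<close>

primrec level :: "real \<Rightarrow> (nat \<Rightarrow> real \<times> real \<times> real) \<Rightarrow> nat \<Rightarrow> real" where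
  "level x w 0 = x"
| "level x w (Suc n) = (1 + fst (snd (w n))) * (level x w n - fst (w n)) + snd (snd (w n))"

text \<open>Triples are ordered (interarrival time, proportion, gain size). The inequality is not
  strict: if the surplus would reach 0 exactly at a gain epoch, that gain is already counted at this
  instant.\<close>

definition survives :: "real \<Rightarrow> (nat \<Rightarrow> real \<times> real \<times> real) \<Rightarrow> nat \<Rightarrow> bool" where
  "survives x w n \<longleftrightarrow> (\<forall>i<n. fst (w i) \<le> level x w i)"

definition after_gain :: "real \<Rightarrow> real \<times> real \<times> real \<Rightarrow> real" where
  "after_gain x z = (1 + fst (snd z)) * (x - fst z) + snd (snd z)"

lemma level_case_nat: "level x (case_nat z w) (Suc n) = level (after_gain x z) w n"
  by (induction n) (simp_all add: after_gain_def)

text \<open>The pathwise Markov property: removing the first gain restarts the chain at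
  \<open>after_gain x z\<close>. Conditioning on the first gain rests on it.\<close>

lemma survives_case_nat:
  "survives x (case_nat z w) (Suc n) \<longleftrightarrow> fst z \<le> x \<and> survives (after_gain x z) w n"
  unfolding survives_def All_less_Suc2 level_case_nat by simp

definition gain_seq ::
  "(nat \<Rightarrow> 'a \<Rightarrow> real) \<Rightarrow> (nat \<Rightarrow> 'a \<Rightarrow> real) \<Rightarrow> (nat \<Rightarrow> 'a \<Rightarrow> real) \<Rightarrow> 'a \<Rightarrow> nat \<Rightarrow> real \<times> real \<times> real"
  where "gain_seq T C V \<omega> i = (T i \<omega>, V i \<omega>, C i \<omega>)"

text \<open>Connects the one-step recursion with the sum that defines the model. The link is that
  the level just before a gain is the level after the previous one minus the waiting time.\<close>

lemma level_eq_sum: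
  "level x (gain_seq T C V \<omega>) n = x - (\<Sum>l<n. T l \<omega>) + (\<Sum>l<n. C l \<omega> + V l \<omega> * pre_gain_level T C V x \<omega> l)"
proof (induction n)
  case (Suc n)
  have *: "pre_gain_level T C V x \<omega> n = level x (gain_seq T C V \<omega>) n - T n \<omega>"
    unfolding Suc by (subst pre_gain_level.simps)
      (simp add: arrival_time_def lessThan_Suc_atMost[symmetric])
  then have "level x (gain_seq T C V \<omega>) (Suc n) = level x (gain_seq T C V \<omega>) n - T n \<omega> +
      (C n \<omega> + V n \<omega> * pre_gain_level T C V x \<omega> n)"
    unfolding * by (simp add: gain_seq_def algebra_simps)
  then show ?case
    using Suc by simp
qed simp

lemma surplus_eq_level:
  assumes "num_gains T \<omega> t = n"
  shows "surplus T C V x \<omega> t = level x (gain_seq T C V \<omega>) n + (\<Sum>l<n. T l \<omega>) - t"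
  using assms by (simp add: surplus_def level_eq_sum)

lemma num_gains_eqI:
  assumes pos: "\<And>i. 0 < T i \<omega>" and n: "(\<Sum>l<n. T l \<omega>) \<le> t" "t < (\<Sum>l<Suc n. T l \<omega>)"
  shows "num_gains T \<omega> t = n"
proof -
  have mono: "(\<Sum>l<i. T l \<omega>) \<le> (\<Sum>l<j. T l \<omega>)" if "i \<le> j" for i j
    using that pos by (intro sum_mono2) (auto intro: less_imp_le)
  have "{i. 0 < arrival_time T \<omega> i \<and> arrival_time T \<omega> i \<le> t} = {..<n}"
  proof (intro set_eqI iffI)
    fix i assume "i \<in> {..<n}"
    then show "i \<in> {i. 0 < arrival_time T \<omega> i \<and> arrival_time T \<omega> i \<le> t}"
      using mono[of "Suc i" n] n pos
      by (auto simp: arrival_time_def lessThan_Suc_atMost intro!: sum_pos)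
  next
    fix i assume i: "i \<in> {i. 0 < arrival_time T \<omega> i \<and> arrival_time T \<omega> i \<le> t}"
    show "i \<in> {..<n}"
    proof (rule ccontr)
      assume "i \<notin> {..<n}"
      then show False
        using mono[of "Suc n" "Suc i"] n i
        by (auto simp: arrival_time_def lessThan_Suc_atMost[symmetric])
    qed
  qed
  then show ?thesis by (simp add: num_gains_def)
qed

text \<open>Between gains the surplus falls with slope -1, so it vanishes there exactly when the
  level after the last gain is below the next waiting time. Since the arrival times are unbounded,
  every t lies between two consecutive ones.\<close>

lemma ruin_iff_not_survives:
  assumes pos: "\<And>i. 0 < T i \<omega>" and C: "\<And>i. 0 \<le> C i \<omega>" and V: "\<And>i. 0 \<le> V i \<omega>"
    and unbdd: "\<And>t. \<exists>n. t < (\<Sum>l<n. T l \<omega>)" and x: "0 \<le> x"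
  shows "(\<exists>t\<ge>0. surplus T C V x \<omega> t = 0) \<longleftrightarrow> \<not> (\<forall>n. survives x (gain_seq T C V \<omega>) n)"
proof
  assume "\<exists>t\<ge>0. surplus T C V x \<omega> t = 0"
  then obtain t where t: "t \<ge> 0" "surplus T C V x \<omega> t = 0" by auto
  \<comment> \<open>The least arrival after t has index m, so the number of gains up to t is m -
    1.\<close>
  define m where "m = (LEAST n. t < (\<Sum>l<n. T l \<omega>))"
  have m: "t < (\<Sum>l<m. T l \<omega>)"
    unfolding m_def using unbdd by (rule LeastI_ex)
  with t obtain n where n: "m = Suc n" by (cases m) auto
  then have "(\<Sum>l<n. T l \<omega>) \<le> t"
    using not_less_Least[of n "\<lambda>n. t < (\<Sum>l<n. T l \<omega>)"] m_def by auto
  then have "level x (gain_seq T C V \<omega>) n = t - (\<Sum>l<n. T l \<omega>)"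
    using surplus_eq_level[OF num_gains_eqI[of T \<omega> n t], of C V x] pos m n t by simp
  then have "level x (gain_seq T C V \<omega>) n < T n \<omega>" using m n by simp
  then have "\<not> survives x (gain_seq T C V \<omega>) (Suc n)" by (auto simp: survives_def gain_seq_def)
  then show "\<not> (\<forall>n. survives x (gain_seq T C V \<omega>) n)" by blast
next
  assume "\<not> (\<forall>n. survives x (gain_seq T C V \<omega>) n)"
  then have ex: "\<exists>n. level x (gain_seq T C V \<omega>) n < T n \<omega>" by (auto simp: survives_def gain_seq_def not_le)
  define n where "n = (LEAST n. level x (gain_seq T C V \<omega>) n < T n \<omega>)"
  have n: "level x (gain_seq T C V \<omega>) n < T n \<omega>"
    unfolding n_def using ex by (rule LeastI_ex)
  \<comment> \<open>By minimality of n the previous waiting time did not exceed the level, so the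
    jump started from a nonnegative value; for n = 0 the level is x.\<close>
  have nonneg: "0 \<le> level x (gain_seq T C V \<omega>) n"
  proof (cases n)
    case (Suc m)
    then have "T m \<omega> \<le> level x (gain_seq T C V \<omega>) m"
      using not_less_Least[of m "\<lambda>n. level x (gain_seq T C V \<omega>) n < T n \<omega>"] n_def by auto
    then show ?thesis
      using C V Suc by (simp add: gain_seq_def)
  qed (use x in simp)
  \<comment> \<open>The zero of the linear piece that starts after the n-th gain.\<close>
  define t where "t = level x (gain_seq T C V \<omega>) n + (\<Sum>l<n. T l \<omega>)"
  have "num_gains T \<omega> t = n"
    using nonneg n by (intro num_gains_eqI pos) (simp_all add: t_def)
  then have "surplus T C V x \<omega> t = 0"
    by (simp add: surplus_eq_level t_def)
  moreover have "0 \<le> t"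
    unfolding t_def using nonneg by (intro add_nonneg_nonneg sum_nonneg) (simp_all add: pos less_imp_le)
  ultimately show "\<exists>t\<ge>0. surplus T C V x \<omega> t = 0" by blast
qed

section \<open>Laws of one gain and of the sequence of gains\<close>

context dual_risk_model
begin

definition "law_T = density lborel (\<lambda>t. ennreal (f t))"
definition "law_V = density lborel (\<lambda>v. ennreal (indicator {a..b} v / (b - a)))"
definition "law_C = density lborel (\<lambda>y. ennreal (exponential_density \<mu> y))"

lemma random_variables [measurable]:
  "random_variable borel (T i)" "random_variable borel (C i)" "random_variable borel (V i)"
  using interarrival[of i] gain[of i] proportion[of i] by (auto simp: distributed_def)

lemma distr_T: "distr M borel (T i) = law_T"
  using distributed_distr_eq_density[OF interarrival[of i]]
  unfolding law_T_def by (simp cong: distr_cong)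

lemma distr_V: "distr M borel (V i) = law_V"
  using distributed_distr_eq_density[OF proportion[of i]]
  unfolding law_V_def by (simp cong: distr_cong)

lemma distr_C: "distr M borel (C i) = law_C"
  using distributed_distr_eq_density[OF gain[of i]]
  unfolding law_C_def by (simp cong: distr_cong)

lemma sets_law [measurable_cong, simp]: "sets law_T = sets borel" "sets law_V = sets borel" "sets law_C = sets borel"
  by (simp_all add: law_T_def law_V_def law_C_def)

lemma space_law [simp]: "space law_T = UNIV" "space law_V = UNIV" "space law_C = UNIV"
  by (simp_all add: law_T_def law_V_def law_C_def)

lemma prob_space_law: "prob_space law_T" "prob_space law_V" "prob_space law_C"
  using prob_space_distr[of "T 0" borel] prob_space_distr[of "V 0" borel] prob_space_distr[of "C 0" borel]
  by (simp_all add: distr_T distr_V distr_C)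

lemma f_measurable [measurable]: "f \<in> borel_measurable borel"
  using distributed_real_measurable[OF _ interarrival[of 0]] density_nonneg by simp

lemma AE_law_T: "AE t in law_T. 0 < t"
  unfolding law_T_def
proof (subst AE_density)
  show "AE t in lborel. 0 < ennreal (f t) \<longrightarrow> 0 < t"
    using AE_lborel_singleton[of 0]
  proof eventually_elim
    case (elim t)
    then show ?case using density_support[of t] by (cases "t < 0") auto
  qed
qed simp

lemma AE_law_V: "AE v in law_V. a \<le> v \<and> v \<le> b"
  unfolding law_V_def by (subst AE_density) (auto simp: indicator_def split: if_splits)

lemma AE_law_C: "AE y in law_C. 0 \<le> y"
  unfolding law_C_def
  by (subst AE_density) (auto simp: exponential_density_def split: if_splits)

definition "gain_law = law_T \<Otimes>\<^sub>M (law_V \<Otimes>\<^sub>M law_C)"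

lemma sets_gain_law [measurable_cong, simp]: "sets gain_law = sets (borel \<Otimes>\<^sub>M (borel \<Otimes>\<^sub>M borel))"
  unfolding gain_law_def by (intro sets_pair_measure_cong sets_law)

lemma space_gain_law [simp]: "space gain_law = UNIV"
  unfolding gain_law_def by (simp add: space_pair_measure)

lemma pair_prob_space_law: "pair_prob_space law_V law_C" "pair_prob_space law_T (law_V \<Otimes>\<^sub>M law_C)"
proof -
  show *: "pair_prob_space law_V law_C"
    unfolding pair_prob_space_def pair_sigma_finite_def
    using prob_space_law prob_space_imp_sigma_finite by blast
  have "prob_space (law_V \<Otimes>\<^sub>M law_C)"
    using prob_space_law by (intro prob_space_pair)
  then show "pair_prob_space law_T (law_V \<Otimes>\<^sub>M law_C)"
    unfolding pair_prob_space_def pair_sigma_finite_def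
    by (intro conjI prob_space_law prob_space_imp_sigma_finite)
qed

lemma prob_space_gain_law: "prob_space gain_law"
  unfolding gain_law_def using prob_space_law by (intro prob_space_pair)

text \<open>Independence is assumed for one family indexed by a sum type. Restricting it to disjoint
  index blocks yields first V against C, then T against the pair (V, C), and two product measures
  result.\<close>

lemma distr_gain:
  "distr M (borel \<Otimes>\<^sub>M (borel \<Otimes>\<^sub>M borel)) (\<lambda>\<omega>. (T i \<omega>, V i \<omega>, C i \<omega>)) = gain_law"
proof -
  let ?X = "case_sum T (case_sum C V)"
  have "indep_var borel ((\<lambda>g. g (Inr (Inr i))) \<circ> (\<lambda>\<omega>. restrict (\<lambda>i. ?X i \<omega>) {Inr (Inr i)}))
      borel ((\<lambda>g. g (Inr (Inl i))) \<circ> (\<lambda>\<omega>. restrict (\<lambda>i. ?X i \<omega>) {Inr (Inl i)}))"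
    by (rule indep_var_compose[OF indep_var_restrict[OF independent]]) auto
  then have VC: "indep_var borel (V i) borel (C i)"
    by (simp add: comp_def)
  let ?A = "{Inl i}" and ?B = "{Inr (Inr i), Inr (Inl i)}"
  let ?P = "\<lambda>A. Pi\<^sub>M A (\<lambda>_. borel :: real measure)" and ?R = "\<lambda>A \<omega>. restrict (\<lambda>i. ?X i \<omega>) A"
  let ?f = "\<lambda>g. g (Inl i)" and ?h = "\<lambda>g. (g (Inr (Inr i)), g (Inr (Inl i)))"
  have "indep_var (?P ?A) (?R ?A) (?P ?B) (?R ?B)"
    by (rule indep_var_restrict[OF independent]) auto
  then have rv [measurable]: "random_variable (?P ?A) (?R ?A)" "random_variable (?P ?B) (?R ?B)"
    and eq: "distr M (?P ?A) (?R ?A) \<Otimes>\<^sub>M distr M (?P ?B) (?R ?B) =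
      distr M (?P ?A \<Otimes>\<^sub>M ?P ?B) (\<lambda>\<omega>. (?R ?A \<omega>, ?R ?B \<omega>))"
    unfolding indep_var_distribution_eq by auto
  have [measurable]: "?f \<in> borel_measurable (?P ?A)" "?h \<in> measurable (?P ?B) (borel \<Otimes>\<^sub>M borel)"
    by measurable
  have VC': "law_V \<Otimes>\<^sub>M law_C = distr (distr M (?P ?B) (?R ?B)) (borel \<Otimes>\<^sub>M borel) ?h"
    using VC unfolding indep_var_distribution_eq
    by (subst distr_distr) (simp_all add: distr_V distr_C comp_def)
  have T': "law_T = distr (distr M (?P ?A) (?R ?A)) borel ?f"
    by (subst distr_distr) (simp_all add: distr_T comp_def)
  have "gain_law = distr (distr M (?P ?A) (?R ?A)) borel ?f \<Otimes>\<^sub>M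
      distr (distr M (?P ?B) (?R ?B)) (borel \<Otimes>\<^sub>M borel) ?h"
    unfolding gain_law_def VC' T' ..
  also have "\<dots> = distr (distr M (?P ?A) (?R ?A) \<Otimes>\<^sub>M distr M (?P ?B) (?R ?B))
      (borel \<Otimes>\<^sub>M (borel \<Otimes>\<^sub>M borel)) (\<lambda>(x, y). (?f x, ?h y))"
    by (rule pair_measure_distr)
      (use pair_prob_space_law in \<open>auto simp: VC'[symmetric] pair_prob_space_def pair_sigma_finite_def\<close>)
  also have "\<dots> = distr M (borel \<Otimes>\<^sub>M (borel \<Otimes>\<^sub>M borel)) (\<lambda>\<omega>. (T i \<omega>, V i \<omega>, C i \<omega>))"
    unfolding eq by (subst distr_distr) (simp_all add: comp_def)
  finally show ?thesis ..
qed

abbreviation "gains \<equiv> gain_seq T C V"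

definition "seq_law = Pi\<^sub>M (UNIV :: nat set) (\<lambda>_. gain_law)"

lemma sets_seq_law [measurable_cong, simp]:
  "sets seq_law = sets (Pi\<^sub>M (UNIV :: nat set) (\<lambda>_. borel \<Otimes>\<^sub>M (borel \<Otimes>\<^sub>M borel)))"
  unfolding seq_law_def by (intro sets_PiM_cong) auto

lemma space_seq_law [simp]: "space seq_law = UNIV"
  unfolding seq_law_def by (simp add: space_PiM)

lemma prob_space_seq_law: "prob_space seq_law"
  unfolding seq_law_def using prob_space_gain_law by (intro prob_space_PiM)

lemma gains_measurable [measurable]:
  "gains \<in> measurable M (Pi\<^sub>M UNIV (\<lambda>_. borel \<Otimes>\<^sub>M (borel \<Otimes>\<^sub>M borel)))"
proof -
  have "gains = (\<lambda>\<omega> i. (T i \<omega>, V i \<omega>, C i \<omega>))" by (simp add: gain_seq_def fun_eq_iff)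
  then show ?thesis
    by (simp add: measurable_PiM_single' space_pair_measure)
qed

text \<open>The blocks \<open>K i\<close> collect the three indices of the i-th gain, so the triples
  are independent. This moves the problem to a product space, where the first factor can be split
  off.\<close>

lemma distr_gains:
  "distr M (Pi\<^sub>M UNIV (\<lambda>_. borel \<Otimes>\<^sub>M (borel \<Otimes>\<^sub>M borel))) gains = seq_law"
proof -
  let ?X = "case_sum T (case_sum C V)"
  define K :: "nat \<Rightarrow> (nat + nat + nat) set"
    where "K i = {Inl i, Inr (Inl i), Inr (Inr i)}" for i
  have "indep_vars (\<lambda>j. Pi\<^sub>M (K j) (\<lambda>_. borel)) (\<lambda>j \<omega>. restrict (\<lambda>i. ?X i \<omega>) (K j)) UNIV"
    by (rule indep_vars_restrict[OF independent]) (auto simp: K_def disjoint_family_on_def)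
  then have "indep_vars (\<lambda>_. borel \<Otimes>\<^sub>M (borel \<Otimes>\<^sub>M borel))
      (\<lambda>j \<omega>. (\<lambda>g. (g (Inl j), g (Inr (Inr j)), g (Inr (Inl j)))) (restrict (\<lambda>i. ?X i \<omega>) (K j))) UNIV"
    by (rule indep_vars_compose2) (auto simp: K_def)
  then have "indep_vars (\<lambda>_. borel \<Otimes>\<^sub>M (borel \<Otimes>\<^sub>M borel)) (\<lambda>i \<omega>. (T i \<omega>, V i \<omega>, C i \<omega>)) (UNIV :: nat set)"
    by (simp add: K_def)
  moreover have "gains = (\<lambda>\<omega>. \<lambda>i\<in>UNIV. (T i \<omega>, V i \<omega>, C i \<omega>))"
    by (simp add: gain_seq_def fun_eq_iff)
  ultimately show ?thesis
    by (subst (asm) indep_vars_iff_distr_eq_PiM) (simp_all add: seq_law_def distr_gain)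
qed

lemma level_measurable [measurable]:
  "(\<lambda>p. level (fst p) (snd p) n) \<in> borel_measurable (borel \<Otimes>\<^sub>M Pi\<^sub>M UNIV (\<lambda>_. borel \<Otimes>\<^sub>M (borel \<Otimes>\<^sub>M borel)))"
  by (induction n) simp_all

lemma survives_measurable [measurable]:
  "Measurable.pred (borel \<Otimes>\<^sub>M Pi\<^sub>M UNIV (\<lambda>_. borel \<Otimes>\<^sub>M (borel \<Otimes>\<^sub>M borel))) (\<lambda>p. survives (fst p) (snd p) n)"
  unfolding survives_def by measurable

lemma survives_measurable' [measurable]:
  "Measurable.pred (Pi\<^sub>M UNIV (\<lambda>_. borel \<Otimes>\<^sub>M (borel \<Otimes>\<^sub>M borel))) (\<lambda>w. survives x w n)"
  using measurable_compose[OF measurable_Pair1' survives_measurable[of n], of x] by simp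

lemma sets_Collect_survives [measurable]:
  "{w. survives x w n} \<in> sets seq_law" "{w. \<forall>n. survives x w n} \<in> sets seq_law"
proof -
  have "{w \<in> space seq_law. survives x w n} \<in> sets seq_law" "{w \<in> space seq_law. \<forall>n. survives x w n} \<in> sets seq_law"
    by measurable
  then show "{w. survives x w n} \<in> sets seq_law" "{w. \<forall>n. survives x w n} \<in> sets seq_law"
    by simp_all
qed

section \<open>Survival probabilities and their integral equation\<close>

definition survival_upto :: "nat \<Rightarrow> real \<Rightarrow> real" where
  "survival_upto n x = measure seq_law {w. survives x w n}"

definition survival :: "real \<Rightarrow> real" where
  "survival x = measure seq_law {w. \<forall>n. survives x w n}"

lemma survival_upto_eq: "survival_upto n x = (\<integral>w. indicator {w. survives x w n} w \<partial>seq_law)"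
  unfolding survival_upto_def by simp

lemma survival_upto_measurable [measurable]: "survival_upto n \<in> borel_measurable borel"
proof -
  interpret S: prob_space seq_law by (rule prob_space_seq_law)
  have "survival_upto n = (\<lambda>x. \<integral>w. indicator {p. survives (fst p) (snd p) n} (x, w) \<partial>seq_law)"
    by (simp add: fun_eq_iff survival_upto_eq indicator_def)
  also have "\<dots> \<in> borel_measurable borel"
    by measurable
  finally show ?thesis .
qed

lemma survival_upto_bounds: "0 \<le> survival_upto n x" "survival_upto n x \<le> 1"
proof -
  interpret S: prob_space seq_law by (rule prob_space_seq_law)
  show "0 \<le> survival_upto n x" "survival_upto n x \<le> 1"
    by (simp_all add: survival_upto_def)
qed

lemma survival_upto_LIMSEQ: "(\<lambda>n. survival_upto n x) \<longlonglongrightarrow> survival x"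
proof -
  interpret S: prob_space seq_law by (rule prob_space_seq_law)
  have "{w. \<forall>n. survives x w n} = (\<Inter>n. {w. survives x w n})"
    by auto
  moreover have "range (\<lambda>n. {w. survives x w n}) \<subseteq> sets seq_law"
    using sets_Collect_survives by auto
  moreover have "decseq (\<lambda>n. {w. survives x w n})"
    by (auto simp: decseq_def survives_def)
  ultimately show ?thesis
    unfolding survival_upto_def survival_def by (simp add: S.finite_Lim_measure_decseq)
qed

lemma survival_measurable [measurable]: "survival \<in> borel_measurable borel"
  by (rule borel_measurable_LIMSEQ_real[OF survival_upto_LIMSEQ survival_upto_measurable])

lemma survival_bounds: "0 \<le> survival x" "survival x \<le> 1"
  using survival_upto_LIMSEQ[of x] survival_upto_bounds
  by (auto intro: LIMSEQ_le_const LIMSEQ_le_const2)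

lemma survival_upto_0: "survival_upto 0 x = 1"
proof -
  interpret S: prob_space seq_law by (rule prob_space_seq_law)
  show ?thesis
    using S.prob_space by (simp add: survival_upto_def survives_def)
qed

lemma after_gain_measurable [measurable]:
  "(\<lambda>p. after_gain (fst p) (snd p)) \<in> borel_measurable (borel \<Otimes>\<^sub>M (borel \<Otimes>\<^sub>M (borel \<Otimes>\<^sub>M borel)))"
  "after_gain x \<in> borel_measurable (borel \<Otimes>\<^sub>M (borel \<Otimes>\<^sub>M borel))"
  unfolding after_gain_def by measurable

text \<open>Conditioning on the first gain: \<open>seq_law\<close> is the image of
  \<open>gain_law\<close> times \<open>seq_law\<close> under \<open>case_nat\<close>, and the
  indicator of survival factors by \<open>survives_case_nat\<close>.\<close>

lemma survival_upto_Suc: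
  "survival_upto (Suc n) x = (\<integral>z. indicator {..x} (fst z) * survival_upto n (after_gain x z) \<partial>gain_law)"
proof -
  interpret S: prob_space seq_law by (rule prob_space_seq_law)
  interpret G: prob_space gain_law by (rule prob_space_gain_law)
  interpret sequence_space gain_law ..
  interpret P: pair_prob_space gain_law seq_law ..
  have "survival_upto (Suc n) x = (\<integral>w. indicator {w. survives x w (Suc n)} w \<partial>seq_law)"
    by (rule survival_upto_eq)
  also have "seq_law = distr (gain_law \<Otimes>\<^sub>M seq_law) seq_law (\<lambda>(s, \<omega>). case_nat s \<omega>)"
    using PiM_iter unfolding seq_law_def by simp
  also have "(\<integral>w. (indicator {w. survives x w (Suc n)} w :: real) \<partial>\<dots>) =
      (\<integral>p. indicator {w. survives x w (Suc n)} (case_nat (fst p) (snd p)) \<partial>(gain_law \<Otimes>\<^sub>M seq_law))"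
    by (subst integral_distr) (auto simp add: case_prod_beta seq_law_def)
  also have "\<dots> = (\<integral>p. indicator {..x} (fst (fst p)) * indicator {w. survives (after_gain x (fst p)) w n} (snd p)
      \<partial>(gain_law \<Otimes>\<^sub>M seq_law))"
    by (intro Bochner_Integration.integral_cong refl) (auto simp: survives_case_nat indicator_def)
  also have "\<dots> = (\<integral>z. \<integral>w. indicator {..x} (fst z) * indicator {w. survives (after_gain x z) w n} w \<partial>seq_law \<partial>gain_law)"
  proof (subst P.integral_fst'[symmetric])
    \<comment> \<open>The set inside the second indicator depends on the point. Written through the
      set of pairs (level, sequence), the integrand becomes jointly measurable.\<close>
    have *: "(\<lambda>p. indicator {..x} (fst (fst p)) * indicator {w. survives (after_gain x (fst p)) w n} (snd p)) =
      (\<lambda>p. indicator {..x} (fst (fst p)) *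
        indicator {p. survives (fst p) (snd p) n} (after_gain x (fst p), snd p) :: real)"
      by (simp add: fun_eq_iff indicator_def)
    have "(\<lambda>p. (after_gain x (fst p), snd p)) \<in>
        measurable (gain_law \<Otimes>\<^sub>M seq_law) (borel \<Otimes>\<^sub>M Pi\<^sub>M UNIV (\<lambda>_. borel \<Otimes>\<^sub>M (borel \<Otimes>\<^sub>M borel)))"
      by measurable
    from measurable_compose[OF this survives_measurable[of n]]
    have [measurable]: "Measurable.pred (gain_law \<Otimes>\<^sub>M seq_law) (\<lambda>p. survives (after_gain x (fst p)) (snd p) n)"
      by simp
    show "integrable (gain_law \<Otimes>\<^sub>M seq_law)
       (\<lambda>p. indicator {..x} (fst (fst p)) * indicator {w. survives (after_gain x (fst p)) w n} (snd p) :: real)"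
      unfolding * by (rule P.P.integrable_const_bound[where B=1]) (simp_all add: indicator_def)
  qed simp
  finally show ?thesis
    by (simp add: survival_upto_def)
qed

text \<open>The equation of the model, stated for 1 - R. The term 1 - B(x) disappears, since
  survival requires the first gain to arrive by time x.\<close>

lemma survival_eq:
  "survival x = (\<integral>z. indicator {..x} (fst z) * survival (after_gain x z) \<partial>gain_law)"
proof -
  interpret G: prob_space gain_law by (rule prob_space_gain_law)
  have "(\<lambda>n. \<integral>z. indicator {..x} (fst z) * survival_upto n (after_gain x z) \<partial>gain_law) \<longlonglongrightarrow>
      (\<integral>z. indicator {..x} (fst z) * survival (after_gain x z) \<partial>gain_law)"
  proof (rule integral_dominated_convergence[where w="\<lambda>_. 1"])
    show "AE z in gain_law. (\<lambda>n. indicator {..x} (fst z) * survival_upto n (after_gain x z)) \<longlonglongrightarrow>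
        indicator {..x} (fst z) * survival (after_gain x z)"
      by (intro always_eventually allI tendsto_mult tendsto_const survival_upto_LIMSEQ)
    show "\<And>n. AE z in gain_law. norm (indicator {..x} (fst z) * survival_upto n (after_gain x z)) \<le> 1"
      using survival_upto_bounds by (auto simp: indicator_def)
  qed auto
  then have "(\<lambda>n. survival_upto (Suc n) x) \<longlonglongrightarrow>
      (\<integral>z. indicator {..x} (fst z) * survival (after_gain x z) \<partial>gain_law)"
    by (simp add: survival_upto_Suc)
  then show ?thesis
    using LIMSEQ_Suc[OF survival_upto_LIMSEQ] LIMSEQ_unique by blast
qed

section \<open>Almost sure regularity of the paths and identification with the ruin
  probability\<close>

lemma AE_T_pos: "AE \<omega> in M. 0 < T i \<omega>"
  using AE_law_T unfolding distr_T[of i, symmetric] by (subst (asm) AE_distr_iff) auto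

lemma AE_V_nonneg: "AE \<omega> in M. 0 \<le> V i \<omega>"
proof -
  have "AE v in law_V. 0 \<le> v"
    using AE_law_V a_pos by (auto elim: eventually_mono)
  then show ?thesis
    unfolding distr_V[of i, symmetric] by (subst (asm) AE_distr_iff) auto
qed

lemma AE_C_nonneg: "AE \<omega> in M. 0 \<le> C i \<omega>"
  using AE_law_C unfolding distr_C[of i, symmetric] by (subst (asm) AE_distr_iff) auto

(* The partial sums stay below k with probability at most exp k times E exp(-S_n) = q^n. *)
lemma AE_arrival_unbounded: "AE \<omega> in M. \<forall>t. \<exists>n. t < (\<Sum>l<n. T l \<omega>)"
proof -
  define q where "q = (\<integral>t. exp (- t) \<partial>law_T)"
  interpret LT: prob_space law_T by (rule prob_space_law)
  have bnd: "AE t in law_T. norm (exp (- t)) \<le> (1::real)"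
    using AE_law_T by eventually_elim simp
  have int: "integrable law_T (\<lambda>t. exp (- t) :: real)"
    by (rule LT.integrable_const_bound[OF bnd]) simp
  have q0: "0 \<le> q" unfolding q_def by (intro integral_nonneg_AE) simp
  have q1: "q < 1" unfolding q_def
    by (rule LT.expectation_less[OF int]) (use AE_law_T in \<open>auto elim: eventually_mono\<close>)
  have "indep_vars (\<lambda>_. borel) (\<lambda>i. case_sum T (case_sum C V) (Inl i)) (UNIV :: nat set)"
  proof -
    have "indep_vars (\<lambda>j. Pi\<^sub>M {Inl j} (\<lambda>_. borel))
       (\<lambda>j \<omega>. restrict (\<lambda>i. case_sum T (case_sum C V) i \<omega>) {Inl j}) (UNIV :: nat set)"
      by (rule indep_vars_restrict[OF independent]) (auto simp: disjoint_family_on_def)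
    then have "indep_vars (\<lambda>_. borel) (\<lambda>j \<omega>. (\<lambda>g. g (Inl j)) (restrict (\<lambda>i. case_sum T (case_sum C V) i \<omega>) {Inl j}))
       (UNIV :: nat set)"
      by (rule indep_vars_compose2) auto
    then show ?thesis by simp
  qed
  then have "indep_vars (\<lambda>_. borel) (\<lambda>i \<omega>. exp (- case_sum T (case_sum C V) (Inl i) \<omega>)) (UNIV :: nat set)"
    by (rule indep_vars_compose2) auto
  then have ind: "indep_vars (\<lambda>_. borel) (\<lambda>i \<omega>. exp (- T i \<omega>)) {..<n}" for n
    by (auto intro: indep_vars_subset)
  have intT: "integrable M (\<lambda>\<omega>. exp (- T i \<omega>))" for i
    using int unfolding distr_T[of i, symmetric] by (subst (asm) integrable_distr_eq) auto
  have expT: "expectation (\<lambda>\<omega>. exp (- T i \<omega>)) = q" for i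
    unfolding q_def distr_T[of i, symmetric] by (subst integral_distr) auto
  have prod: "expectation (\<lambda>\<omega>. \<Prod>i<n. exp (- T i \<omega>)) = q ^ n"
    and iprod: "integrable M (\<lambda>\<omega>. \<Prod>i<n. exp (- T i \<omega>))" for n
    using indep_vars_lebesgue_integral[OF _ ind[of n] intT] indep_vars_integrable[OF _ ind[of n] intT]
    by (simp_all add: expT)
  have null: "prob {\<omega> \<in> space M. \<forall>n. (\<Sum>l<n. T l \<omega>) \<le> real k} = 0" (is "prob ?E = 0") for k
  proof -
    have E [measurable]: "?E \<in> events" by measurable
    have "exp (- real k) * prob ?E \<le> q ^ n" for n
    proof -
      have "exp (- real k) * prob ?E = expectation (\<lambda>\<omega>. exp (- real k) * indicator ?E \<omega>)"
        by simp
      also have "\<dots> \<le> expectation (\<lambda>\<omega>. \<Prod>i<n. exp (- T i \<omega>))"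
      proof (rule integral_mono[OF _ iprod])
        fix \<omega>
        show "exp (- real k) * indicator ?E \<omega> \<le> (\<Prod>i<n. exp (- T i \<omega>))"
          by (auto simp: indicator_def exp_sum[symmetric] sum_negf intro: prod_nonneg)
      qed (use E in \<open>simp add: integrable_real_indicator emeasure_eq_measure\<close>)
      finally show ?thesis by (simp add: prod)
    qed
    then have "exp (- real k) * prob ?E \<le> 0"
      using LIMSEQ_power_zero[of q] q0 q1
      by (intro LIMSEQ_le_const[of "\<lambda>n. q ^ n" 0]) auto
    then show ?thesis
      by (simp add: mult_le_0_iff not_le) (use measure_nonneg in \<open>simp add: antisym\<close>)
  qed
  have "AE \<omega> in M. \<forall>k::nat. \<exists>n. real k < (\<Sum>l<n. T l \<omega>)"
    unfolding AE_all_countable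
  proof
    fix k :: nat
    have "AE \<omega> in M. \<omega> \<notin> {\<omega> \<in> space M. \<forall>n. (\<Sum>l<n. T l \<omega>) \<le> real k}"
      by (rule AE_not_in, rule null_setsI) (use null in \<open>simp_all add: emeasure_eq_measure\<close>)
    then show "AE \<omega> in M. \<exists>n. real k < (\<Sum>l<n. T l \<omega>)"
      using AE_space by eventually_elim (auto simp: not_le)
  qed
  then show ?thesis
  proof eventually_elim
    case (elim \<omega>)
    show ?case
    proof
      fix t
      obtain k :: nat where "t \<le> real k" using real_arch_simple by blast
      with elim show "\<exists>n. t < (\<Sum>l<n. T l \<omega>)" by (meson le_less_trans)
    qed
  qed
qed

lemma pre_gain_level_measurable [measurable]:
  "(\<lambda>\<omega>. pre_gain_level T C V x \<omega> n) \<in> borel_measurable M"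
proof (induction n rule: less_induct)
  case (less n)
  have [measurable]: "(\<lambda>\<omega>. \<Sum>l<n. C l \<omega> + V l \<omega> * pre_gain_level T C V x \<omega> l) \<in> borel_measurable M"
    using less by (intro borel_measurable_sum borel_measurable_add borel_measurable_times) auto
  show ?case
    unfolding pre_gain_level.simps[of T C V x _ n] arrival_time_def by measurable
qed

(* M need not be complete, so ruin has to be measurable as it stands, null sets included:
   if n gains have occurred by the time of ruin, then that time is h n. *)
lemma ruin_event: "{\<omega> \<in> space M. \<exists>t\<ge>0. surplus T C V x \<omega> t = 0} \<in> events"
proof -
  define h where "h n \<omega> = x + (\<Sum>i<n. C i \<omega> + V i \<omega> * pre_gain_level T C V x \<omega> i)" for n \<omega>
  have [measurable]: "h n \<in> borel_measurable M" for n
    unfolding h_def by measurable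
  have "(\<exists>t\<ge>0. surplus T C V x \<omega> t = 0) \<longleftrightarrow>
      (\<exists>n. 0 \<le> h n \<omega> \<and> num_gains T \<omega> (h n \<omega>) = n)" for \<omega>
  proof
    assume "\<exists>t\<ge>0. surplus T C V x \<omega> t = 0"
    then obtain t where t: "0 \<le> t" "surplus T C V x \<omega> t = 0" by auto
    then have "h (num_gains T \<omega> t) \<omega> = t" by (simp add: surplus_def h_def)
    with t show "\<exists>n. 0 \<le> h n \<omega> \<and> num_gains T \<omega> (h n \<omega>) = n"
      by (intro exI[of _ "num_gains T \<omega> t"]) simp
  next
    assume "\<exists>n. 0 \<le> h n \<omega> \<and> num_gains T \<omega> (h n \<omega>) = n"
    then obtain n where n: "0 \<le> h n \<omega>" "num_gains T \<omega> (h n \<omega>) = n" by auto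
    then have "surplus T C V x \<omega> (h n \<omega>) = 0"
      unfolding surplus_def n(2) by (simp add: h_def)
    with n show "\<exists>t\<ge>0. surplus T C V x \<omega> t = 0" by blast
  qed
  then have "{\<omega> \<in> space M. \<exists>t\<ge>0. surplus T C V x \<omega> t = 0} =
      {\<omega> \<in> space M. \<exists>n. 0 \<le> h n \<omega> \<and> num_gains T \<omega> (h n \<omega>) = n}"
    by simp
  also have "\<dots> \<in> events"
    unfolding num_gains_def arrival_time_def by measurable
  finally show ?thesis .
qed

lemma ruin_prob_eq_survival:
  assumes "0 \<le> x"
  shows "ruin_prob M T C V x = 1 - survival x"
proof -
  have E: "{\<omega> \<in> space M. \<forall>n. survives x (gains \<omega>) n} \<in> events"
    by measurable
  have pos: "AE \<omega> in M. \<forall>i. 0 < T i \<omega> \<and> 0 \<le> V i \<omega> \<and> 0 \<le> C i \<omega>"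
    unfolding AE_all_countable by (intro allI AE_conjI AE_T_pos AE_V_nonneg AE_C_nonneg)
  \<comment> \<open>The two events are compared only where waiting times are positive, gains are
    nonnegative and arrivals are unbounded, a set of full measure.\<close>
  have "AE \<omega> in M. (\<exists>t\<ge>0. surplus T C V x \<omega> t = 0) \<longleftrightarrow> \<not> (\<forall>n. survives x (gains \<omega>) n)"
    using pos AE_arrival_unbounded
  proof eventually_elim
    case (elim \<omega>)
    then show ?case
      using ruin_iff_not_survives[of T \<omega> C V x] assms by blast
  qed
  then have "ruin_prob M T C V x = prob {\<omega> \<in> space M. \<not> (\<forall>n. survives x (gains \<omega>) n)}"
    unfolding ruin_prob_def
    using E by (intro finite_measure_eq_AE ruin_event) (simp_all add: pred_def)
  also have "\<dots> = 1 - prob {\<omega> \<in> space M. \<forall>n. survives x (gains \<omega>) n}"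
    using prob_neg[OF E] by simp
  also have "prob {\<omega> \<in> space M. \<forall>n. survives x (gains \<omega>) n} = survival x"
    unfolding survival_def distr_gains[symmetric]
    by (subst measure_distr) (use sets_Collect_survives in \<open>auto intro!: arg_cong[where f=prob]\<close>)
  finally show ?thesis .
qed

end

section \<open>Laplace transforms\<close>

lemma (in pair_sigma_finite) integrable_mult_fst_snd:
  fixes f g :: "_ \<Rightarrow> real"
  assumes f [measurable]: "integrable M1 f" and g [measurable]: "integrable M2 g"
  shows "integrable (M1 \<Otimes>\<^sub>M M2) (\<lambda>p. f (fst p) * g (snd p))"
proof (rule Fubini_integrable)
  show "integrable M1 (\<lambda>x. \<integral>y. norm (f (fst (x, y)) * g (snd (x, y))) \<partial>M2)"
    using f by (simp add: abs_mult)
qed (use g in simp_all)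

text \<open>The Laplace kernel is cut off to the left of 0, so that transforms become integrals over
  the whole line, ready for translation, scaling and Fubini.\<close>

definition decay :: "complex \<Rightarrow> real \<Rightarrow> complex" where
  "decay s x = indicator {0..} x *\<^sub>R exp (- (s * of_real x))"

lemma decay_measurable [measurable]:
  "decay s \<in> borel_measurable borel"
  "(\<lambda>p. decay (fst p) (snd p)) \<in> borel_measurable (borel \<Otimes>\<^sub>M borel)"
  unfolding decay_def[abs_def] by measurable

lemma norm_decay: "norm (decay s x) = indicator {0..} x * exp (- (Re s * x))"
  by (simp add: decay_def indicator_def)

lemma laplace_transform_eq_decay:
  "laplace_transform R s = (\<integral>x. decay s x * of_real (R x) \<partial>lborel)"
  unfolding laplace_transform_def set_lebesgue_integral_def decay_def by simp

lemma exponential_density_integral: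
  assumes "0 < l"
  shows "integrable lborel (exponential_density l)" "(\<integral>x. exponential_density l x \<partial>lborel) = 1"
proof -
  interpret D: prob_space "density lborel (exponential_density l)"
    by (rule prob_space_exponential_density[OF assms])
  have nn: "0 \<le> exponential_density l x" for x
    using assms by (simp add: exponential_density_def)
  show "integrable lborel (exponential_density l)"
    using D.integrable_const[of "1::real"] integrable_density[of "\<lambda>_. 1::real" lborel "exponential_density l"] nn
    by simp
  show "(\<integral>x. exponential_density l x \<partial>lborel) = 1"
    using D.prob_space integral_density[of "\<lambda>_. 1::real" lborel "exponential_density l"] nn by simp
qed

text \<open>The norm is the exponential density of rate Re s, divided by Re s.\<close>

lemma has_bochner_integral_norm_decay:
  assumes "0 < Re s"
  shows "has_bochner_integral lborel (\<lambda>x. norm (decay s x)) (1 / Re s)"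
proof -
  have "has_bochner_integral lborel (exponential_density (Re s)) 1"
    using exponential_density_integral[OF assms] by (simp add: has_bochner_integral_iff)
  then have "has_bochner_integral lborel (\<lambda>x. 1 / Re s * exponential_density (Re s) x) (1 / Re s * 1)"
    by (rule has_bochner_integral_mult_right)
  moreover have "1 / Re s * exponential_density (Re s) x = norm (decay s x)" for x
    using assms by (auto simp: norm_decay exponential_density_def mult.commute)
  ultimately show ?thesis by simp
qed

lemma integrable_norm_decay: "0 < Re s \<Longrightarrow> integrable lborel (\<lambda>x. norm (decay s x))"
  using has_bochner_integral_norm_decay by (simp add: has_bochner_integral_iff)

lemma integrable_decay_mult:
  assumes "0 < Re s" and [measurable]: "g \<in> borel_measurable borel" and "\<And>x. norm (g x) \<le> 1"
  shows "integrable lborel (\<lambda>x. decay s x * g x)"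
  by (rule Bochner_Integration.integrable_bound[OF integrable_norm_decay[OF assms(1)]])
    (use assms in \<open>auto simp: norm_mult intro!: mult_left_le AE_I2\<close>)

lemma norm_integral_decay_le:
  assumes "0 < Re s" and [measurable]: "g \<in> borel_measurable borel" and "\<And>x. norm (g x) \<le> 1"
  shows "norm (\<integral>x. decay s x * g x \<partial>lborel) \<le> 1 / Re s"
proof -
  have "norm (\<integral>x. decay s x * g x \<partial>lborel) \<le> (\<integral>x. norm (decay s x) \<partial>lborel)"
    by (rule Bochner_Integration.integral_norm_bound_integral)
      (use assms in \<open>auto simp: norm_mult intro!: mult_left_le integrable_decay_mult integrable_norm_decay\<close>)
  also have "\<dots> = 1 / Re s"
    using has_bochner_integral_norm_decay[OF assms(1)] by (rule has_bochner_integral_integral_eq)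
  finally show ?thesis .
qed

text \<open>Only c nonzero is required: the formula is also applied to c = s - mu m, whose real part
  may have any sign.\<close>

lemma integral_exp_Icc:
  fixes c :: complex
  assumes "c \<noteq> 0" "0 \<le> u"
  shows "(\<integral>x. indicator {0..u} x *\<^sub>R exp (- (c * of_real x)) \<partial>lborel) = (1 - exp (- (c * of_real u))) / c"
proof -
  have "(\<integral>x. indicator {0..u} x *\<^sub>R exp (- (c * of_real x)) \<partial>lborel) =
      - exp (- (c * of_real u)) / c - (- exp (- (c * of_real 0)) / c)"
  proof (rule integral_FTC_Icc)
    show "((\<lambda>x. - exp (- (c * of_real x)) / c) has_vector_derivative exp (- (c * of_real x))) (at x within {0..u})" for x
      by (rule has_vector_derivative_real_field[where f="\<lambda>z. - exp (- (c * z)) / c"])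
        (use assms in \<open>auto intro!: derivative_eq_intros\<close>)
  qed (use assms in \<open>auto intro!: continuous_intros\<close>)
  then show ?thesis by (simp add: diff_divide_distrib)
qed

lemma integral_decay:
  assumes "0 < Re s"
  shows "(\<integral>x. decay s x \<partial>lborel) = 1 / s"
proof -
  have s: "s \<noteq> 0" using assms by auto
  have "(\<lambda>n. \<integral>x. indicator {0..real n} x *\<^sub>R exp (- (s * of_real x)) \<partial>lborel) \<longlonglongrightarrow> (\<integral>x. decay s x \<partial>lborel)"
  proof (rule integral_dominated_convergence[OF _ _ integrable_norm_decay[OF assms]])
    show "AE x in lborel. (\<lambda>n. indicator {0..real n} x *\<^sub>R exp (- (s * of_real x))) \<longlonglongrightarrow> decay s x"
    proof (rule AE_I2, rule tendsto_eventually)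
      fix x :: real
      obtain N :: nat where N: "x \<le> real N" using real_arch_simple by blast
      show "\<forall>\<^sub>F n in sequentially. indicator {0..real n} x *\<^sub>R exp (- (s * of_real x)) = decay s x"
        using eventually_ge_at_top[of N]
      proof eventually_elim
        case (elim n)
        with N have "x \<le> real n" by (meson le_trans of_nat_le_iff order_trans)
        then show ?case by (simp add: decay_def indicator_def)
      qed
    qed
    show "AE x in lborel. norm (indicator {0..real n} x *\<^sub>R exp (- (s * of_real x))) \<le> norm (decay s x)" for n
      by (auto simp: decay_def indicator_def)
  qed (auto simp: decay_def)
  moreover have "(\<lambda>n. \<integral>x. indicator {0..real n} x *\<^sub>R exp (- (s * of_real x)) \<partial>lborel) \<longlonglongrightarrow> 1 / s"
  proof -
    have "(\<lambda>n. exp (- (s * of_real (real n)))) \<longlonglongrightarrow> 0"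
    proof (rule tendsto_norm_zero_cancel)
      have "norm (exp (- (s * of_real (real n)))) = exp (- Re s) ^ n" for n
        by (simp add: exp_of_nat_mult[symmetric] mult.commute)
      then show "(\<lambda>n. norm (exp (- (s * of_real (real n))))) \<longlonglongrightarrow> 0"
        using assms by (simp add: LIMSEQ_realpow_zero)
    qed
    then have "(\<lambda>n. (1 - exp (- (s * of_real (real n)))) / s) \<longlonglongrightarrow> (1 - 0) / s"
      using s by (intro tendsto_intros)
    then show ?thesis
      by (subst integral_exp_Icc) (use s in simp_all)
  qed
  ultimately show ?thesis by (rule LIMSEQ_unique)
qed

text \<open>With w = m z + y the exponential density splits into exp(-mu w) exp(mu m z). For fixed w
  the variable z runs through [0, w/m], and integrating exp(-(s - mu m) z) there leaves a difference
  of exp(-mu w) and exp(-s w/m). These are the kernels of the transforms at mu and at s/m.\<close>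

lemma exp_shift_integral:
  fixes Q :: "real \<Rightarrow> real" and \<mu> m :: real
  assumes [measurable]: "Q \<in> borel_measurable borel" and Q: "\<And>x. 0 \<le> Q x" "\<And>x. Q x \<le> 1"
    and \<mu>: "0 < \<mu>" and m: "0 < m" and s: "0 < Re s" "s \<noteq> of_real (\<mu> * m)"
  shows "(\<integral>y. \<integral>z. decay s z * of_real (Q (m * z + y)) \<partial>lborel \<partial>density lborel (exponential_density \<mu>)) =
    of_real \<mu> / (of_real (\<mu> * m) - s) *
      (laplace_transform Q (s / of_real m) - laplace_transform Q (of_real \<mu>))"
proof -
  let ?d = "exponential_density \<mu>"
  have d0: "0 \<le> ?d y" for y using \<mu> by (simp add: exponential_density_def)
  interpret D: prob_space "density lborel ?d" by (rule prob_space_exponential_density[OF \<mu>])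
  note int_d = exponential_density_integral(1)[OF \<mu>]
  have Q1: "norm (Q x) \<le> 1" for x using Q[of x] by simp
  have meas_inner [measurable]: "(\<lambda>y. \<integral>z. decay s z * of_real (Q (m * z + y)) \<partial>lborel) \<in> borel_measurable borel"
    by measurable
  \<comment> \<open>\<open>h\<close> is the integrand in the variables (y, z), \<open>g\<close> the
    same integrand after w = m z + y. Fubini is applied once to each, on both sides of the
    substitution.\<close>
  define h where "h y z = of_real (?d y) * (decay s z * of_real (Q (m * z + y)))" for y z
  define g where "g z w = of_real (?d (w - m * z)) * (decay s z * of_real (Q w))" for z w
  have [measurable]: "case_prod h \<in> borel_measurable (lborel \<Otimes>\<^sub>M lborel)"
    "case_prod g \<in> borel_measurable (lborel \<Otimes>\<^sub>M lborel)"
    unfolding h_def g_def by measurable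
  have int_h: "integrable (lborel \<Otimes>\<^sub>M lborel) (case_prod h)"
  proof (rule Bochner_Integration.integrable_bound[OF lborel_pair.integrable_mult_fst_snd[OF int_d integrable_norm_decay[OF s(1)]]])
    show "AE p in lborel \<Otimes>\<^sub>M lborel. norm (case_prod h p) \<le> norm (?d (fst p) * norm (decay s (snd p)))"
      using d0 Q by (auto simp: h_def norm_mult abs_mult intro!: AE_I2 mult_left_mono mult_left_le)
  qed simp
  have int_shift: "integrable lborel (\<lambda>w. ?d (w - c))" "(\<integral>w. ?d (w - c) \<partial>lborel) = 1" for c
  proof -
    show "integrable lborel (\<lambda>w. ?d (w - c))"
      using lborel_integrable_real_affine[OF int_d, of 1 "- c"] by simp
    have "(\<integral>w. ?d (w - c) \<partial>lborel) = (\<integral>w. ?d w \<partial>lborel)"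
      using lborel_integral_real_affine[of 1 ?d "- c"] by simp
    also have "\<dots> = 1"
      by (rule exponential_density_integral(2)[OF \<mu>])
    finally show "(\<integral>w. ?d (w - c) \<partial>lborel) = 1" .
  qed
  have g_le: "norm (g z w) \<le> norm (decay s z) * ?d (w - m * z)" for z w
    using Q[of w] d0[of "w - m * z"] by (simp add: g_def norm_mult mult.assoc mult.left_commute mult_left_le)
      (smt (verit) mult_left_le mult_left_mono norm_ge_zero)
  have int_g: "integrable lborel (g z)" for z
    by (rule Bochner_Integration.integrable_bound[of lborel "\<lambda>w. norm (decay s z) * ?d (w - m * z)"])
      (use g_le[of z] d0 int_shift in \<open>auto simp: g_def\<close>)
  have int_g2: "integrable (lborel \<Otimes>\<^sub>M lborel) (case_prod g)"
  proof (rule lborel_pair.Fubini_integrable)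
    show "integrable lborel (\<lambda>z. \<integral>w. norm (case_prod g (z, w)) \<partial>lborel)"
    proof (rule Bochner_Integration.integrable_bound[OF integrable_norm_decay[OF s(1)]])
      have "(\<integral>w. norm (g z w) \<partial>lborel) \<le> (\<integral>w. norm (decay s z) * ?d (w - m * z) \<partial>lborel)" for z
        using int_g[of z] int_shift[of "m * z"] g_le by (intro integral_mono) auto
      then show "AE z in lborel. norm (\<integral>w. norm (case_prod g (z, w)) \<partial>lborel) \<le> norm (norm (decay s z))"
        using int_shift by (intro AE_I2) simp
    qed measurable
  qed (use int_g in auto)
  have inner: "(\<integral>z. g z w \<partial>lborel) = of_real \<mu> / (of_real (\<mu> * m) - s) *
      (decay (s / of_real m) w * of_real (Q w) - decay (of_real \<mu>) w * of_real (Q w))" for w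
  proof (cases "0 \<le> w")
    case False
    then have "g z w = 0" for z
      using m by (auto simp: g_def decay_def indicator_def exponential_density_def)
        (smt (verit) mult_nonneg_nonneg)
    with False show ?thesis by (simp add: decay_def)
  next
    case True
    \<comment> \<open>The exponent that remains once the density has contributed exp(mu m z);
      \<open>c\<close> is nonzero because s is not the pole.\<close>
    define c where "c = s - of_real (\<mu> * m)"
    have c: "c \<noteq> 0" using s by (simp add: c_def)
    have "g z w = (of_real \<mu> * exp (- of_real (\<mu> * w)) * of_real (Q w)) *
        (indicator {0..w / m} z *\<^sub>R exp (- (c * of_real z)))" for z
      using m by (auto simp: g_def decay_def indicator_def exponential_density_def c_def field_simps
          exp_of_real[symmetric] exp_add[symmetric] exp_diff[symmetric])
    then have "(\<integral>z. g z w \<partial>lborel) = (of_real \<mu> * exp (- of_real (\<mu> * w)) * of_real (Q w)) *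
        (\<integral>z. indicator {0..w / m} z *\<^sub>R exp (- (c * of_real z)) \<partial>lborel)"
      by (simp only: integral_mult_right_zero)
    then have "(\<integral>z. g z w \<partial>lborel) = (of_real \<mu> * exp (- of_real (\<mu> * w)) * of_real (Q w)) *
        ((1 - exp (- (c * of_real (w / m)))) / c)"
      using integral_exp_Icc[OF c, of "w / m"] True m by simp
    moreover have "exp (- of_real (\<mu> * w)) * exp (- (c * of_real (w / m))) = exp (- (s / of_real m * of_real w))"
      using m by (simp add: c_def exp_add[symmetric] field_simps)
    ultimately show ?thesis
      using True c s by (simp add: decay_def c_def field_simps)
  qed
  have "(\<integral>y. \<integral>z. decay s z * of_real (Q (m * z + y)) \<partial>lborel \<partial>density lborel ?d) =
      (\<integral>y. \<integral>z. h y z \<partial>lborel \<partial>lborel)"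
    using d0 by (subst integral_density) (auto simp: h_def[abs_def] scaleR_conv_of_real)
  also have "\<dots> = (\<integral>z. \<integral>y. h y z \<partial>lborel \<partial>lborel)"
    using lborel_pair.Fubini_integral[OF int_h] by simp
  also have "\<dots> = (\<integral>z. \<integral>w. g z w \<partial>lborel \<partial>lborel)"
  proof (rule Bochner_Integration.integral_cong[OF refl])
    fix z show "(\<integral>y. h y z \<partial>lborel) = (\<integral>w. g z w \<partial>lborel)"
      using lborel_integral_real_affine[of 1 "\<lambda>y. h y z" "- (m * z)"] by (simp add: h_def g_def)
  qed
  also have "\<dots> = (\<integral>w. \<integral>z. g z w \<partial>lborel \<partial>lborel)"
    using lborel_pair.Fubini_integral[OF int_g2] by simp
  also have "\<dots> = of_real \<mu> / (of_real (\<mu> * m) - s) *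
      (laplace_transform Q (s / of_real m) - laplace_transform Q (of_real \<mu>))"
    unfolding inner laplace_transform_eq_decay
    using s m \<mu> Q1 by (subst integral_mult_right_zero, subst Bochner_Integration.integral_diff)
      (auto intro!: integrable_decay_mult simp: Re_divide_of_real)
  finally show ?thesis .
qed

lemma laplace_transform_measurable [measurable]:
  assumes [measurable]: "R \<in> borel_measurable borel"
  shows "laplace_transform R \<in> borel_measurable borel"
  unfolding laplace_transform_eq_decay[abs_def] by measurable

context dual_risk_model
begin

abbreviation "\<phi> \<equiv> laplace_stieltjes law_T"

lemma phi_measurable [measurable]: "\<phi> \<in> borel_measurable borel"
proof -
  interpret LT: prob_space law_T by (rule prob_space_law)
  show ?thesis unfolding laplace_stieltjes_def[abs_def] by measurable
qed

text \<open>The transform of \<open>survival_eq\<close>. Measuring the initial level from the first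
  waiting time t separates the factor exp(-s t), whose mean is \<open>\<phi> s\<close>; the gain
  size is then integrated by \<open>exp_shift_integral\<close>.\<close>

lemma laplace_survival:
  assumes s: "0 < Re s" and pole: "\<And>v. v \<in> {a..b} \<Longrightarrow> s \<noteq> of_real (\<mu> * (1 + v))"
  shows "laplace_transform survival s = (LBINT v:{a..b}. \<phi> s / of_real (b - a) *
    (of_real \<mu> / (of_real (\<mu> * (1 + v)) - s) *
      (laplace_transform survival (s / of_real (1 + v)) - laplace_transform survival (of_real \<mu>))))"
proof -
  interpret G: prob_space gain_law by (rule prob_space_gain_law)
  interpret LT: prob_space law_T by (rule prob_space_law)
  interpret VC: pair_prob_space law_V law_C by (rule pair_prob_space_law)
  interpret TVC: pair_prob_space law_T "law_V \<Otimes>\<^sub>M law_C" by (rule pair_prob_space_law)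
  interpret LG: pair_sigma_finite lborel gain_law ..
  have surv [simp]: "\<bar>survival x\<bar> \<le> 1" for x using survival_bounds[of x] by simp
  define k where "k x \<zeta> = decay s x * of_real (indicator {..x} (fst \<zeta>) * survival (after_gain x \<zeta>))" for x \<zeta>
  define J where "J p = (\<integral>z. decay s z * of_real (survival ((1 + fst p) * z + snd p)) \<partial>lborel)" for p
  have [measurable]: "(\<lambda>p. indicator {..fst p} (fst (snd p)) :: real) \<in> borel_measurable (lborel \<Otimes>\<^sub>M gain_law)"
  proof -
    have *: "(\<lambda>p. indicator {..fst p} (fst (snd p)) :: real) =
        (\<lambda>p. if fst (snd p) \<le> fst p then 1 else 0)"
      by (simp add: fun_eq_iff indicator_def)
    show ?thesis unfolding * by measurable
  qed
  have [measurable]: "case_prod k \<in> borel_measurable (lborel \<Otimes>\<^sub>M gain_law)"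
    unfolding k_def by measurable
  have [measurable]: "J \<in> borel_measurable (law_V \<Otimes>\<^sub>M law_C)"
    unfolding J_def by measurable
  have J_le: "norm (J p) \<le> 1 / Re s" for p
    unfolding J_def by (rule norm_integral_decay_le[OF s]) auto
  have int_k: "integrable (lborel \<Otimes>\<^sub>M gain_law) (case_prod k)"
  proof (rule Bochner_Integration.integrable_bound[OF LG.integrable_mult_fst_snd[OF integrable_norm_decay[OF s] G.integrable_const[of 1]]])
    show "AE p in lborel \<Otimes>\<^sub>M gain_law. norm (case_prod k p) \<le> norm (norm (decay s (fst p)) * 1)"
      by (rule AE_I2) (auto simp: k_def norm_mult indicator_def intro!: mult_left_le)
  qed simp
  have "laplace_transform survival s = (\<integral>x. \<integral>\<zeta>. k x \<zeta> \<partial>gain_law \<partial>lborel)"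
    unfolding laplace_transform_eq_decay k_def
    by (subst survival_eq) (simp add: integral_complex_of_real[symmetric] del: of_real_mult integral_complex_of_real)
  also have "\<dots> = (\<integral>\<zeta>. \<integral>x. k x \<zeta> \<partial>lborel \<partial>gain_law)"
    using LG.Fubini_integral[OF int_k] by simp
  also have "\<dots> = (\<integral>t. \<integral>p. \<integral>x. k x (t, p) \<partial>lborel \<partial>(law_V \<Otimes>\<^sub>M law_C) \<partial>law_T)"
    unfolding gain_law_def
    using LG.integrable_snd[OF int_k] by (subst TVC.integral_fst') (auto simp: gain_law_def)
  also have "\<dots> = (\<integral>t. exp (- (s * of_real t)) * (\<integral>p. J p \<partial>(law_V \<Otimes>\<^sub>M law_C)) \<partial>law_T)"
  proof (rule integral_cong_AE)
    \<comment> \<open>Substitution x = t + z. For t > 0 the condition t \<le> x implies 0 \<le> x,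
      so the two cutoffs merge into the single cutoff of \<open>decay s z\<close>.\<close>
    have "(\<integral>x. k x (t, p) \<partial>lborel) = exp (- (s * of_real t)) * J p" if "0 < t" for t p
    proof -
      have "(\<integral>x. k x (t, p) \<partial>lborel) = (\<integral>z. k (t + z) (t, p) \<partial>lborel)"
        using lborel_integral_real_affine[of 1 "\<lambda>x. k x (t, p)" t] by simp
      also have "\<dots> = (\<integral>z. exp (- (s * of_real t)) * (decay s z * of_real (survival ((1 + fst p) * z + snd p))) \<partial>lborel)"
        using that by (intro Bochner_Integration.integral_cong refl)
          (auto simp: k_def decay_def indicator_def after_gain_def algebra_simps exp_add exp_minus exp_diff divide_simps)
      finally show ?thesis by (simp add: J_def)
    qed
    then show "AE t in law_T. (\<integral>p. \<integral>x. k x (t, p) \<partial>lborel \<partial>(law_V \<Otimes>\<^sub>M law_C)) =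
        exp (- (s * of_real t)) * (\<integral>p. J p \<partial>(law_V \<Otimes>\<^sub>M law_C))"
      by (intro eventually_mono[OF AE_law_T]) simp
  qed measurable
  also have "\<dots> = \<phi> s * (\<integral>p. J p \<partial>(law_V \<Otimes>\<^sub>M law_C))"
    by (simp add: laplace_stieltjes_def)
  also have "(\<integral>p. J p \<partial>(law_V \<Otimes>\<^sub>M law_C)) = (\<integral>v. \<integral>y. J (v, y) \<partial>law_C \<partial>law_V)"
    by (rule VC.integral_fst'[symmetric], rule VC.P.integrable_const_bound[where B="1 / Re s"]) (use J_le in auto)
  also have "\<dots> = (\<integral>v. of_real \<mu> / (of_real (\<mu> * (1 + v)) - s) *
      (laplace_transform survival (s / of_real (1 + v)) - laplace_transform survival (of_real \<mu>)) \<partial>law_V)"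
  proof (rule integral_cong_AE)
    have "(\<integral>y. J (v, y) \<partial>law_C) = of_real \<mu> / (of_real (\<mu> * (1 + v)) - s) *
      (laplace_transform survival (s / of_real (1 + v)) - laplace_transform survival (of_real \<mu>))"
      if "a \<le> v" "v \<le> b" for v
      unfolding J_def law_C_def fst_conv snd_conv
      by (rule exp_shift_integral) (use that a_pos mu_pos s pole[of v] survival_bounds in auto)
    then show "AE v in law_V. (\<integral>y. J (v, y) \<partial>law_C) = of_real \<mu> / (of_real (\<mu> * (1 + v)) - s) *
      (laplace_transform survival (s / of_real (1 + v)) - laplace_transform survival (of_real \<mu>))"
      by (intro eventually_mono[OF AE_law_V]) blast
  qed measurable
  also have "\<dots> = (LBINT v:{a..b}. 1 / of_real (b - a) * (of_real \<mu> / (of_real (\<mu> * (1 + v)) - s) *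
      (laplace_transform survival (s / of_real (1 + v)) - laplace_transform survival (of_real \<mu>))))"
    unfolding law_V_def set_lebesgue_integral_def
    using a_less_b by (subst integral_density)
      (auto intro!: Bochner_Integration.integral_cong simp: indicator_def scaleR_conv_of_real)
  also have "\<phi> s * \<dots> = (LBINT v:{a..b}. \<phi> s * (1 / of_real (b - a) * (of_real \<mu> / (of_real (\<mu> * (1 + v)) - s) *
      (laplace_transform survival (s / of_real (1 + v)) - laplace_transform survival (of_real \<mu>)))))"
    by (rule set_integral_mult_right[symmetric])
  finally show ?thesis by simp
qed

end

section \<open>The functional equation of the ruin transform\<close>

lemma set_integrable_bounded:
  fixes g :: "_ \<Rightarrow> _ :: {banach, second_countable_topology}"
  assumes "A \<in> sets M" "g \<in> borel_measurable M" "emeasure M A < \<infinity>" "\<And>x. x \<in> A \<Longrightarrow> norm (g x) \<le> B"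
  shows "set_integrable M A g"
  unfolding set_integrable_def
  using assms by (intro integrableI_bounded_set_indicator) auto

text \<open>The antiderivative is the logarithm of the quotient by its denominator at v = a. Thus
  the lower endpoint gives ln 1 = 0 and the upper one gives exactly the quotient in
  \<open>source_L\<close>, without combining two branches.\<close>

lemma kernel_integral:
  fixes a b \<mu> :: real and s :: complex
  assumes ab: "a \<le> b" and \<mu>: "0 < \<mu>" and pole: "\<And>v. v \<in> {a..b} \<Longrightarrow> s \<noteq> of_real (\<mu> * (1 + v))"
  shows "set_integrable lborel {a..b} (\<lambda>v. of_real \<mu> / (of_real (\<mu> * (1 + v)) - s))" (is ?int)
    and "(LBINT v:{a..b}. of_real \<mu> / (of_real (\<mu> * (1 + v)) - s)) =
      ln ((of_real ((1 + b) * \<mu>) - s) / (of_real ((1 + a) * \<mu>) - s))" (is ?eq)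
proof -
  let ?g = "\<lambda>v. of_real \<mu> / (of_real (\<mu> * (1 + v)) - s)"
  let ?c = "of_real (\<mu> * (1 + a)) - s"
  have c: "?c \<noteq> 0" using pole[of a] ab by auto
  have nz: "of_real (\<mu> * (1 + v)) - s \<noteq> 0" if "v \<in> {a..b}" for v
    using pole[OF that] by simp
  have cont: "continuous_on {a..b} ?g"
    by (intro continuous_intros ballI nz)
  have bi: "has_bochner_integral lborel (\<lambda>v. indicator {a..b} v *\<^sub>R ?g v)
      (ln ((of_real (\<mu> * (1 + b)) - s) / ?c) - ln ((of_real (\<mu> * (1 + a)) - s) / ?c))"
  proof (rule has_bochner_integral_FTC_Icc[OF ab _ cont])
    fix v assume v: "a \<le> v" "v \<le> b"
    \<comment> \<open>The principal branch is safe: a value q \<le> 0 of the quotient would make s =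
      mu (1 + u) with u = (v - q a) / (1 - q), a convex combination of v and a, hence a point of
      [a, b] that the pole condition excludes.\<close>
    have "(of_real (\<mu> * (1 + v)) - s) / ?c \<notin> \<real>\<^sub>\<le>\<^sub>0"
    proof
      assume "(of_real (\<mu> * (1 + v)) - s) / ?c \<in> \<real>\<^sub>\<le>\<^sub>0"
      then obtain q where q: "q \<le> 0" "(of_real (\<mu> * (1 + v)) - s) / ?c = of_real q"
        by (auto elim: nonpos_Reals_cases)
      then have "of_real (\<mu> * (1 + v)) - s = of_real q * ?c"
        using c by (simp add: field_simps)
      then have "s * of_real (1 - q) = of_real (\<mu> * (1 + v) - q * (\<mu> * (1 + a)))"
        by (simp add: algebra_simps)
      then have "s = of_real (\<mu> * (1 + v) - q * (\<mu> * (1 + a))) / of_real (1 - q)"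
      proof -
        have "(of_real (1 - q) :: complex) \<noteq> 0" using q(1) by (simp only: of_real_eq_0_iff)
        then show ?thesis using \<open>s * of_real (1 - q) = _\<close> by (simp only: eq_divide_eq if_True not_False_eq_True)
      qed
      also have "\<dots> = of_real (\<mu> * (1 + (v - q * a) / (1 - q)))"
        using q(1) by (simp add: divide_simps) (simp add: algebra_simps)
      finally have "s = of_real (\<mu> * (1 + (v - q * a) / (1 - q)))" .
      moreover have "(v - q * a) / (1 - q) \<in> {a..b}"
      proof -
        have "q * (b - a) \<le> 0" using q(1) ab by (simp add: mult_nonpos_nonneg)
        then show ?thesis using q(1) v by (simp add: divide_simps algebra_simps)
      qed
      ultimately show False using pole by blast
    qed
    then have "((\<lambda>z. ln ((of_real \<mu> * (1 + z) - s) / ?c)) has_field_derivative ?g v) (at (of_real v))"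
      using c nz[of v] v by (auto intro!: derivative_eq_intros simp: divide_simps)
    from has_vector_derivative_real_field[OF this]
    show "((\<lambda>v. ln ((of_real (\<mu> * (1 + v)) - s) / ?c)) has_vector_derivative ?g v) (at v within {a..b})"
      by simp
  qed
  from bi show ?int by (simp add: set_integrable_def has_bochner_integral_iff)
  from bi c show ?eq
    by (simp add: set_lebesgue_integral_def has_bochner_integral_iff mult.commute)
qed

context dual_risk_model
begin

abbreviation "\<rho> \<equiv> laplace_transform (ruin_prob M T C V)"

text \<open>\<open>ruin_prob\<close> is identified only for x \<ge> 0, but \<open>decay\<close>
  vanishes elsewhere. Measurability of \<open>\<rho>\<close> thus follows from that of
  \<open>survival\<close>.\<close>

lemma rho_eq_decay: "\<rho> s = (\<integral>x. decay s x * of_real (1 - survival x) \<partial>lborel)"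
  unfolding laplace_transform_eq_decay
  by (intro Bochner_Integration.integral_cong refl)
    (auto simp: decay_def indicator_def ruin_prob_eq_survival)

lemma rho_measurable [measurable]: "\<rho> \<in> borel_measurable borel"
  unfolding rho_eq_decay[abs_def] by measurable

lemma rho_eq_survival:
  assumes "0 < Re s"
  shows "\<rho> s = 1 / s - laplace_transform survival s"
proof -
  have i: "integrable lborel (\<lambda>x. decay s x * of_real (survival x))"
    using assms survival_bounds by (intro integrable_decay_mult) (auto simp: abs_le_iff intro: order_trans)
  have i1: "integrable lborel (decay s)"
    using integrable_decay_mult[of s "\<lambda>_. 1"] assms by simp
  have "\<rho> s = (\<integral>x. decay s x - decay s x * of_real (survival x) \<partial>lborel)"
    unfolding rho_eq_decay by (simp add: algebra_simps)
  also have "\<dots> = 1 / s - laplace_transform survival s"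
    unfolding laplace_transform_eq_decay integral_decay[OF assms, symmetric]
    by (rule Bochner_Integration.integral_diff[OF i1 i])
  finally show ?thesis .
qed

lemma norm_rho_le: "0 < Re s \<Longrightarrow> norm (\<rho> s) \<le> 1 / Re s"
  unfolding rho_eq_decay
proof (rule norm_integral_decay_le)
  show "norm (of_real (1 - survival x) :: complex) \<le> 1" for x
    using survival_bounds[of x] unfolding norm_of_real by simp
qed simp_all

lemma
  assumes "0 < Re s"
  shows norm_phi_le: "norm (\<phi> s) \<le> Re (\<phi> (of_real (Re s)))"
    and phi_of_real: "\<phi> (of_real (Re s)) = of_real (Re (\<phi> (of_real (Re s))))"
    and Re_phi_le_1: "Re (\<phi> (of_real (Re s))) \<le> 1"
    and Re_phi_eq: "Re (\<phi> (of_real (Re s))) = (\<integral>t. exp (- (Re s * t)) \<partial>law_T)"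
proof -
  interpret LT: prob_space law_T by (rule prob_space_law)
  have bnd: "AE t in law_T. norm (exp (- (Re s * t))) \<le> 1"
    using AE_law_T by (rule eventually_mono) (use assms in simp)
  have int: "integrable law_T (\<lambda>t. exp (- (Re s * t)))"
    by (rule LT.integrable_const_bound[OF bnd]) simp
  have eq: "\<phi> (of_real (Re s)) = of_real (\<integral>t. exp (- (Re s * t)) \<partial>law_T)"
    unfolding laplace_stieltjes_def integral_complex_of_real[symmetric]
    by (simp add: exp_of_real[symmetric])
  show e: "Re (\<phi> (of_real (Re s))) = (\<integral>t. exp (- (Re s * t)) \<partial>law_T)"
    unfolding eq by simp
  show "\<phi> (of_real (Re s)) = of_real (Re (\<phi> (of_real (Re s))))"
    unfolding e by (rule eq)
  have "norm (\<phi> s) \<le> (\<integral>t. norm (exp (- (s * of_real t))) \<partial>law_T)"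
    unfolding laplace_stieltjes_def by (rule integral_norm_bound)
  then show "norm (\<phi> s) \<le> Re (\<phi> (of_real (Re s)))"
    unfolding e by simp
  show "Re (\<phi> (of_real (Re s))) \<le> 1"
    unfolding e using bnd LT.integral_le_const[OF int, of 1] by (auto elim: eventually_mono)
qed

lemma kernel_rho_integrable:
  assumes s: "0 < Re s" and pole: "\<And>v. v \<in> {a..b} \<Longrightarrow> s \<noteq> of_real (\<mu> * (1 + v))"
  shows "set_integrable lborel {a..b} (\<lambda>v. kernel_k \<phi> \<mu> a b s v * \<rho> (s / of_real (1 + v)))"
proof -
  have nz: "of_real (\<mu> * (1 + v)) - s \<noteq> 0" if "v \<in> {a..b}" for v
    using pole[OF that] by simp
  have "continuous_on {a..b} (kernel_k \<phi> \<mu> a b s)"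
    unfolding kernel_k_def by (intro continuous_intros ballI nz) (use a_less_b in simp)
  then have "bounded (kernel_k \<phi> \<mu> a b s ` {a..b})"
    by (intro compact_imp_bounded compact_continuous_image) auto
  then obtain B where B: "norm (kernel_k \<phi> \<mu> a b s v) \<le> B" if "v \<in> {a..b}" for v
    unfolding bounded_iff by blast
  show ?thesis
  proof (rule set_integrable_bounded)
    show "norm (kernel_k \<phi> \<mu> a b s v * \<rho> (s / of_real (1 + v))) \<le> B * ((1 + b) / Re s)"
      if v: "v \<in> {a..b}" for v
      unfolding norm_mult
    proof (rule mult_mono[OF B[OF v]])
      have "norm (\<rho> (s / of_real (1 + v))) \<le> 1 / Re (s / of_real (1 + v))"
        using v a_pos s by (intro norm_rho_le) (simp add: Re_divide_of_real)
      also have "\<dots> \<le> (1 + b) / Re s"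
        using v a_pos s by (simp add: Re_divide_of_real divide_right_mono)
      finally show "norm (\<rho> (s / of_real (1 + v))) \<le> (1 + b) / Re s" .
      show "0 \<le> B" using B[OF v] norm_ge_zero order_trans by blast
    qed simp
  qed (auto simp: kernel_k_def emeasure_lborel_Icc_eq)
qed

text \<open>Insert 1 / z minus the transform of ruin for the transform of survival. The explicit
  parts integrate to \<open>\<phi> s / s\<close>, the part with \<open>\<rho>\<close> at mu to the
  logarithm, and the rest is the kernel integral.\<close>

theorem rho_functional_equation:
  assumes s: "0 < Re s" and pole: "\<And>v. v \<in> {a..b} \<Longrightarrow> s \<noteq> of_real (\<mu> * (1 + v))"
  shows "\<rho> s = source_L \<phi> \<rho> \<mu> a b s + (LBINT v:{a..b}. kernel_k \<phi> \<mu> a b s v * \<rho> (s / of_real (1 + v)))"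
proof -
  let ?g = "\<lambda>v. of_real \<mu> / (of_real (\<mu> * (1 + v)) - s)"
  let ?A = "\<phi> s / of_real (b - a)"
  have s0: "s \<noteq> 0" using s by auto
  note ki = kernel_integral[OF less_imp_le[OF a_less_b] mu_pos pole]
  have pt: "\<phi> s / of_real (b - a) * (?g v * (laplace_transform survival (s / of_real (1 + v)) -
        laplace_transform survival (of_real \<mu>))) =
      (?A / s + ?A * \<rho> (of_real \<mu>) * ?g v) - kernel_k \<phi> \<mu> a b s v * \<rho> (s / of_real (1 + v))"
    if v: "v \<in> {a..b}" for v
  proof -
    have v1: "0 < 1 + v" using v a_pos by simp
    have nz: "of_real (\<mu> * (1 + v)) - s \<noteq> 0" using pole[OF v] by auto
    have "laplace_transform survival (s / of_real (1 + v)) - laplace_transform survival (of_real \<mu>) =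
        (of_real (1 + v) / s - 1 / of_real \<mu>) + \<rho> (of_real \<mu>) - \<rho> (s / of_real (1 + v))"
      using rho_eq_survival[of "s / of_real (1 + v)"] rho_eq_survival[of "of_real \<mu>"] s v1 mu_pos
      by (simp add: Re_divide_of_real)
    moreover have "A * (G * (c + r - q)) = A * (G * c) + A * r * G - A * G * q" for A G c r q :: complex
      by (simp add: algebra_simps)
    \<comment> \<open>The pole cancels: (1 + v)/s - 1/mu equals (mu (1 + v) - s)/(mu s).\<close>
    moreover have "?g v * (of_real (1 + v) / s - 1 / of_real \<mu>) = 1 / s"
      using nz s0 mu_pos by (simp add: divide_simps)
    ultimately show ?thesis
      by (simp only: kernel_k_def mult_1_right times_divide_eq_right)
  qed
  have c1: "set_integrable lborel {a..b} (\<lambda>v. ?A / s)"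
    by (rule set_integrable_bounded[where B="norm (?A / s)"]) (auto simp: emeasure_lborel_Icc_eq)
  have c2: "set_integrable lborel {a..b} (\<lambda>v. ?A * \<rho> (of_real \<mu>) * ?g v)"
    using ki(1) by (rule set_integrable_mult_right)
  have "laplace_transform survival s = (LBINT v:{a..b}. (?A / s + ?A * \<rho> (of_real \<mu>) * ?g v) -
      kernel_k \<phi> \<mu> a b s v * \<rho> (s / of_real (1 + v)))"
    by (subst laplace_survival[OF s pole], assumption, rule set_lebesgue_integral_cong)
      (use pt in \<open>simp_all only: sets_lborel borel_closed closed_atLeastAtMost ballI\<close>, blast)
  also have "\<dots> = (LBINT v:{a..b}. ?A / s) + (LBINT v:{a..b}. ?A * \<rho> (of_real \<mu>) * ?g v) -
      (LBINT v:{a..b}. kernel_k \<phi> \<mu> a b s v * \<rho> (s / of_real (1 + v)))"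
    using c1 c2 kernel_rho_integrable[OF s pole] by (simp add: set_integral_add set_integral_diff)
  also have "(LBINT v:{a..b}. ?A / s) = \<phi> s / s"
    using a_less_b by (simp add: set_lebesgue_integral_def scaleR_conv_of_real)
  also have "(LBINT v:{a..b}. ?A * \<rho> (of_real \<mu>) * ?g v) = ?A * \<rho> (of_real \<mu>) *
      ln ((of_real ((1 + b) * \<mu>) - s) / (of_real ((1 + a) * \<mu>) - s))"
    by (simp only: set_integral_mult_right ki(2))
  finally show ?thesis
    unfolding rho_eq_survival[OF s] source_L_def by (simp add: diff_divide_distrib)
qed

end

section \<open>Iterated averages and their decay\<close>

context dual_risk_model
begin

definition phi_real :: "real \<Rightarrow> real" where
  "phi_real x = Re (\<phi> (of_real x))"

text \<open>The mean of phi(x) g(x/(1+V)) for V uniform on [a, b]. It is the positive operator that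
  dominates the kernel on the real axis once the rational factor, weighted by 1 + v, has been
  bounded separately.\<close>

definition averaging :: "(real \<Rightarrow> real) \<Rightarrow> real \<Rightarrow> real" where
  "averaging g x = phi_real x / (b - a) * (LBINT w:{a..b}. g (x / (1 + w)))"

text \<open>Bounds are imposed only for positive arguments, since functions are evaluated at Re s
  divided by growth factors; measurability is on the whole line.\<close>

definition unit_valued :: "(real \<Rightarrow> real) \<Rightarrow> bool" where
  "unit_valued g \<longleftrightarrow> g \<in> borel_measurable borel \<and> (\<forall>x>0. 0 \<le> g x \<and> g x \<le> 1)"

lemma phi_real_measurable [measurable]: "phi_real \<in> borel_measurable borel"
  unfolding phi_real_def by measurable

lemma phi_real_eq: "0 < x \<Longrightarrow> phi_real x = (\<integral>t. exp (- (x * t)) \<partial>law_T)"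
  and phi_real_nonneg: "0 < x \<Longrightarrow> 0 \<le> phi_real x"
  and phi_real_le_1: "0 < x \<Longrightarrow> phi_real x \<le> 1"
  and phi_of_real_eq: "0 < x \<Longrightarrow> \<phi> (of_real x) = of_real (phi_real x)"
  using norm_phi_le[of "of_real x"] phi_of_real[of "of_real x"] Re_phi_le_1[of "of_real x"]
    Re_phi_eq[of "of_real x"] order_trans[OF norm_ge_zero norm_phi_le[of "of_real x"]]
  by (simp_all add: phi_real_def)

lemma norm_phi_le_real: "0 < Re s \<Longrightarrow> norm (\<phi> s) \<le> phi_real (Re s)"
  using norm_phi_le by (simp add: phi_real_def)

lemma averaging_integrable:
  assumes "unit_valued g" "0 < x"
  shows "set_integrable lborel {a..b} (\<lambda>w. g (x / (1 + w)))"
  using assms a_pos unfolding unit_valued_def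
  by (intro set_integrable_bounded[where B=1]) (auto simp: emeasure_lborel_Icc_eq)

lemma averaging_mono:
  assumes g: "unit_valued g" and h: "unit_valued h" and le: "\<And>x. 0 < x \<Longrightarrow> g x \<le> h x" and x: "0 < x"
  shows "averaging g x \<le> averaging h x"
  unfolding averaging_def
  using a_pos a_less_b x le
  by (intro mult_left_mono set_integral_mono averaging_integrable g h divide_nonneg_pos phi_real_nonneg) auto

lemma averaging_const: "averaging (\<lambda>_. c) x = phi_real x * c"
  using a_less_b by (simp add: averaging_def set_lebesgue_integral_def)

lemma averaging_cmult: "averaging (\<lambda>x. c * g x) x = c * averaging g x"
  by (simp add: averaging_def)

lemma unit_valued_averaging:
  assumes g: "unit_valued g"
  shows "unit_valued (averaging g)"
  unfolding unit_valued_def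
proof (intro conjI allI impI)
  have [measurable]: "g \<in> borel_measurable borel" using g by (simp add: unit_valued_def)
  show "averaging g \<in> borel_measurable borel"
    unfolding averaging_def[abs_def] set_lebesgue_integral_def by measurable
  fix x :: real assume x: "0 < x"
  have "averaging (\<lambda>_. 0) x \<le> averaging g x" "averaging g x \<le> averaging (\<lambda>_. 1) x"
    using g x by (auto intro!: averaging_mono simp: unit_valued_def)
  then show "0 \<le> averaging g x" "averaging g x \<le> 1"
    using phi_real_le_1[OF x] by (auto simp: averaging_const)
qed

lemma unit_valued_funpow: "unit_valued g \<Longrightarrow> unit_valued ((averaging ^^ n) g)"
  by (induction n) (auto intro: unit_valued_averaging)

lemma averaging_funpow_mono:
  assumes "unit_valued g" "unit_valued h" "\<And>x. 0 < x \<Longrightarrow> g x \<le> h x" "0 < x"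
  shows "(averaging ^^ n) g x \<le> (averaging ^^ n) h x"
  using assms(4)
proof (induction n arbitrary: x)
  case (Suc n)
  then show ?case
    using assms(1,2) by (auto intro!: averaging_mono unit_valued_funpow)
qed (use assms in simp)

(* The mean of phi(x) phi(x/pi_1) ... phi(x/pi_{n-1}); the limit damping_lim is the function D of the header. *)
definition damping :: "nat \<Rightarrow> real \<Rightarrow> real" where
  "damping n = (averaging ^^ n) (\<lambda>_. 1)"

definition damping_lim :: "real \<Rightarrow> real" where
  "damping_lim x = lim (\<lambda>n. damping n x)"

lemma unit_valued_one: "unit_valued (\<lambda>_. 1)"
  by (simp add: unit_valued_def)

lemma unit_valued_damping: "unit_valued (damping n)"
  unfolding damping_def by (intro unit_valued_funpow unit_valued_one)

lemma damping_bounds: "0 < x \<Longrightarrow> 0 \<le> damping n x" "0 < x \<Longrightarrow> damping n x \<le> 1"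
  using unit_valued_damping[of n] by (auto simp: unit_valued_def)

lemma damping_Suc: "damping (Suc n) = averaging (damping n)"
  by (simp add: damping_def)

text \<open>\<open>averaging\<close> maps the constant 1 below 1, and monotonicity passes this to
  all iterates, so the sequence decreases.\<close>

lemma damping_LIMSEQ:
  assumes "0 < x" shows "(\<lambda>n. damping n x) \<longlonglongrightarrow> damping_lim x"
proof -
  have "damping (Suc n) y \<le> damping n y" if "0 < y" for n y
    unfolding damping_def funpow_Suc_right o_apply
    using that unit_valued_averaging[OF unit_valued_one]
    by (intro averaging_funpow_mono unit_valued_one) (auto simp: unit_valued_def)
  then have "decseq (\<lambda>n. damping n x)"
    using assms by (intro decseq_SucI)
  then have "convergent (\<lambda>n. damping n x)"
    using damping_bounds[OF assms] by (auto intro: decseq_convergent simp: convergent_def)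
  then show ?thesis unfolding damping_lim_def by (simp add: convergent_LIMSEQ_iff)
qed

lemma unit_valued_damping_lim: "unit_valued damping_lim"
  unfolding unit_valued_def
proof (intro conjI allI impI)
  have [measurable]: "damping n \<in> borel_measurable borel" for n
    using unit_valued_damping by (simp add: unit_valued_def)
  show "damping_lim \<in> borel_measurable borel"
    unfolding damping_lim_def[abs_def] by measurable
  fix x :: real assume "0 < x"
  then show "0 \<le> damping_lim x" "damping_lim x \<le> 1"
    using LIMSEQ_le_const[OF damping_LIMSEQ, of x 0] LIMSEQ_le_const2[OF damping_LIMSEQ, of x 1] damping_bounds by auto
qed

lemma averaging_damping_lim:
  assumes x: "0 < x"
  shows "averaging damping_lim x = damping_lim x"
proof -
  have [measurable]: "damping n \<in> borel_measurable borel" "damping_lim \<in> borel_measurable borel" for n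
    using unit_valued_damping unit_valued_damping_lim by (auto simp: unit_valued_def)
  have pos: "0 < x / (1 + w)" if "w \<in> {a..b}" for w
    using that x a_pos by simp
  have "(\<lambda>n. LBINT w:{a..b}. damping n (x / (1 + w))) \<longlonglongrightarrow> (LBINT w:{a..b}. damping_lim (x / (1 + w)))"
    unfolding set_lebesgue_integral_def
  proof (rule integral_dominated_convergence[where w="indicator {a..b}"])
    show "AE w in lborel. (\<lambda>n. indicator {a..b} w *\<^sub>R damping n (x / (1 + w))) \<longlonglongrightarrow>
        indicator {a..b} w *\<^sub>R damping_lim (x / (1 + w))"
      using damping_LIMSEQ[OF pos] by (intro AE_I2) (auto simp: indicator_def)
    show "AE w in lborel. norm (indicator {a..b} w *\<^sub>R damping n (x / (1 + w))) \<le> indicator {a..b} w" for n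
      using damping_bounds[OF pos] by (intro AE_I2) (auto simp: indicator_def)
  qed (auto simp: emeasure_lborel_Icc_eq)
  then have "(\<lambda>n. averaging (damping n) x) \<longlonglongrightarrow> averaging damping_lim x"
    unfolding averaging_def by (intro tendsto_intros)
  moreover have "(\<lambda>n. averaging (damping n) x) \<longlonglongrightarrow> damping_lim x"
    using LIMSEQ_Suc[OF damping_LIMSEQ[OF x]] by (simp add: damping_Suc)
  ultimately show ?thesis by (rule LIMSEQ_unique)
qed

text \<open>The zero-one argument. If the fixed point is at most 1 - \<epsilon> everywhere,
  iterating \<open>averaging\<close> gives \<open>damping_lim\<close> \<le> (1 - \<epsilon>)
  \<open>damping n\<close> for every n. In the limit \<open>damping_lim\<close> is at most (1 -
  \<epsilon>) times itself, hence 0.\<close>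

lemma damping_lim_dichotomy:
  assumes "\<exists>x>0. damping_lim x \<noteq> 0" "0 < \<epsilon>"
  shows "\<exists>\<theta>>0. 1 - \<epsilon> < damping_lim \<theta>"
proof (rule ccontr)
  assume "\<not> ?thesis"
  then have le: "damping_lim \<theta> \<le> 1 - \<epsilon>" if "0 < \<theta>" for \<theta>
    using that by (meson not_le)
  \<comment> \<open>Any positive argument serves here: it yields 1 - \<epsilon> \<ge> 0, which keeps
    (1 - \<epsilon>) \<open>damping n\<close> unit valued for monotonicity.\<close>
  have "0 \<le> damping_lim 1"
    using unit_valued_damping_lim by (simp add: unit_valued_def)
  then have l: "0 \<le> 1 - \<epsilon>" "1 - \<epsilon> \<le> 1"
    using le[of 1] assms(2) by auto
  have "damping_lim x \<le> (1 - \<epsilon>) * damping n x" if "0 < x" for n x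
    using that
  proof (induction n arbitrary: x)
    case 0
    then show ?case using le by (simp add: damping_def)
  next
    case (Suc n)
    have "damping_lim x = averaging damping_lim x"
      using averaging_damping_lim Suc.prems by simp
    also have "\<dots> \<le> averaging (\<lambda>x. (1 - \<epsilon>) * damping n x) x"
      using Suc unit_valued_damping_lim unit_valued_damping[of n] l
      by (intro averaging_mono) (auto simp: unit_valued_def mult_le_one)
    finally show ?case by (simp add: averaging_cmult damping_Suc)
  qed
  then have "damping_lim x \<le> (1 - \<epsilon>) * damping_lim x" if "0 < x" for x
    using that by (intro LIMSEQ_le_const[OF tendsto_mult[OF tendsto_const damping_LIMSEQ]]) auto
  then have "\<epsilon> * damping_lim x \<le> 0" if "0 < x" for x
    using that by (simp add: algebra_simps)
  then have "damping_lim x = 0" if "0 < x" for x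
    using that assms(2) unit_valued_damping_lim
    by (intro antisym) (auto simp: unit_valued_def mult_le_0_iff not_less)
  then show False using assms(1) by auto
qed

section \<open>Lower bound for survival in terms of the damping function\<close>

lemma AE_gain_law: "AE z in gain_law. 0 < fst z \<and> a \<le> fst (snd z) \<and> fst (snd z) \<le> b \<and> 0 \<le> snd (snd z)"
proof -
  have "AE \<omega> in M. a \<le> V 0 \<omega> \<and> V 0 \<omega> \<le> b"
    using AE_law_V unfolding distr_V[of 0, symmetric] by (subst (asm) AE_distr_iff) auto
  then show ?thesis
    unfolding distr_gain[of 0, symmetric]
    using AE_T_pos[of 0] AE_C_nonneg[of 0] by (subst AE_distr_iff) auto
qed

text \<open>Writes \<open>averaging\<close> as an expectation over one gain, so that
  \<open>damping\<close> and \<open>survival_upto\<close> can be compared under the same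
  integral.\<close>

lemma integral_gain_law_mult:
  assumes g: "unit_valued g" and x: "0 < x"
  shows "integrable gain_law (\<lambda>z. exp (- (x * fst z)) * g (x / (1 + fst (snd z))))"
    and "(\<integral>z. exp (- (x * fst z)) * g (x / (1 + fst (snd z))) \<partial>gain_law) = averaging g x"
proof -
  have [measurable]: "g \<in> borel_measurable borel" using g by (simp add: unit_valued_def)
  interpret G: prob_space gain_law by (rule prob_space_gain_law)
  interpret VC: pair_prob_space law_V law_C by (rule pair_prob_space_law)
  interpret TVC: pair_prob_space law_T "law_V \<Otimes>\<^sub>M law_C" by (rule pair_prob_space_law)
  let ?h = "\<lambda>p. g (x / (1 + fst p))"
  show int: "integrable gain_law (\<lambda>z. exp (- (x * fst z)) * g (x / (1 + fst (snd z))))"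
  proof (rule G.integrable_const_bound[where B=1])
    show "AE z in gain_law. norm (exp (- (x * fst z)) * g (x / (1 + fst (snd z)))) \<le> 1"
      using AE_gain_law
    proof eventually_elim
      case (elim z)
      then have "0 < x / (1 + fst (snd z))" using a_pos x by simp
      then have "0 \<le> g (x / (1 + fst (snd z)))" "g (x / (1 + fst (snd z))) \<le> 1"
        using g by (auto simp: unit_valued_def)
      then show ?case using elim x by (simp add: abs_mult mult_le_one)
    qed
  qed simp
  have "integrable law_V (\<lambda>v. g (x / (1 + v)))"
  proof (rule VC.M1.integrable_const_bound[where B=1])
    show "AE v in law_V. norm (g (x / (1 + v))) \<le> 1"
      using AE_law_V
    proof eventually_elim
      case (elim v)
      then have "0 < x / (1 + v)" using a_pos x by simp
      then show ?case using g by (auto simp: unit_valued_def)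
    qed
  qed simp
  then have "integrable (law_V \<Otimes>\<^sub>M law_C) ?h"
    using VC.integrable_mult_fst_snd[of "\<lambda>v. g (x / (1 + v))" "\<lambda>_. 1"] by simp
  then have h: "(\<integral>p. ?h p \<partial>(law_V \<Otimes>\<^sub>M law_C)) = (\<integral>v. g (x / (1 + v)) \<partial>law_V)"
    using VC.M2.prob_space by (subst VC.integral_fst'[symmetric]) auto
  have "(\<integral>z. exp (- (x * fst z)) * g (x / (1 + fst (snd z))) \<partial>gain_law) =
      (\<integral>t. \<integral>p. exp (- (x * t)) * ?h p \<partial>(law_V \<Otimes>\<^sub>M law_C) \<partial>law_T)"
    using int unfolding gain_law_def by (subst TVC.integral_fst'[symmetric]) auto
  also have "\<dots> = phi_real x * (\<integral>v. g (x / (1 + v)) \<partial>law_V)"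
    by (simp add: h phi_real_eq[OF x])
  also have "(\<integral>v. g (x / (1 + v)) \<partial>law_V) = (LBINT v:{a..b}. 1 / (b - a) * g (x / (1 + v)))"
    unfolding law_V_def set_lebesgue_integral_def
    using a_less_b by (subst integral_density)
      (auto intro!: Bochner_Integration.integral_cong simp: indicator_def)
  finally show "(\<integral>z. exp (- (x * fst z)) * g (x / (1 + fst (snd z))) \<partial>gain_law) = averaging g x"
    by (simp add: averaging_def)
qed

text \<open>The rate must vary in the induction: a gain multiplies the remaining level by 1 + v or
  more, so the rate is divided by 1 + v. Rate times level then drops by at most \<theta> t, which
  the factor exp(-\<theta> t) of \<open>averaging\<close> absorbs.\<close>

lemma survival_upto_ge:
  assumes "0 \<le> x" "0 < \<theta>"
  shows "damping n \<theta> - exp (- (\<theta> * x)) \<le> survival_upto n x"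
  using assms
proof (induction n arbitrary: x \<theta>)
  case 0
  then show ?case by (simp add: damping_def survival_upto_0)
next
  case (Suc n)
  interpret G: prob_space gain_law by (rule prob_space_gain_law)
  let ?m = "\<lambda>z. 1 + fst (snd z)"
  note int = integral_gain_law_mult[OF unit_valued_damping[of n] \<open>0 < \<theta>\<close>]
  have int2: "integrable gain_law (\<lambda>z. indicator {..x} (fst z) * survival_upto n (after_gain x z))"
    by (rule G.integrable_const_bound[where B=1])
      (use survival_upto_bounds in \<open>auto simp: indicator_def\<close>)
  have "damping (Suc n) \<theta> - exp (- (\<theta> * x)) =
      (\<integral>z. exp (- (\<theta> * fst z)) * damping n (\<theta> / ?m z) - exp (- (\<theta> * x)) \<partial>gain_law)"
    using int G.prob_space by (simp add: damping_Suc)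
  also have "\<dots> \<le> (\<integral>z. indicator {..x} (fst z) * survival_upto n (after_gain x z) \<partial>gain_law)"
  proof (rule integral_mono_AE[OF _ int2])
    show "integrable gain_law (\<lambda>z. exp (- (\<theta> * fst z)) * damping n (\<theta> / ?m z) - exp (- (\<theta> * x)))"
      using int(1) by simp
    show "AE z in gain_law. exp (- (\<theta> * fst z)) * damping n (\<theta> / ?m z) - exp (- (\<theta> * x)) \<le>
        indicator {..x} (fst z) * survival_upto n (after_gain x z)"
      using AE_gain_law
    proof eventually_elim
      case (elim z)
      define t m P where "t = fst z" and "m = ?m z" and "P = damping n (\<theta> / m)"
      have m: "0 < m" and t: "0 < t" using elim a_pos by (auto simp: m_def t_def)
      have P: "P \<le> 1" "0 \<le> P" using damping_bounds[of "\<theta> / m" n] m Suc.prems by (auto simp: P_def)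
      have e: "exp (- (\<theta> * x)) = exp (- (\<theta> * t)) * exp (- (\<theta> * (x - t)))"
        by (simp add: exp_add[symmetric] algebra_simps)
      show ?case
      proof (cases "t \<le> x")
        case False
        \<comment> \<open>Ruin before the first gain: survival is 0 and the left side is already
          nonpositive.\<close>
        then have "exp (- (\<theta> * t)) \<le> exp (- (\<theta> * x))" using Suc.prems by simp
        then have "exp (- (\<theta> * t)) * P \<le> exp (- (\<theta> * x))"
          using P by (smt (verit) exp_gt_zero mult_left_le)
        then show ?thesis using False by (simp add: t_def P_def m_def)
      next
        case True
        have ag: "m * (x - t) \<le> after_gain x z" "0 \<le> after_gain x z"
          using elim True m by (auto simp: after_gain_def m_def t_def)
        have "\<theta> * (x - t) = \<theta> / m * (m * (x - t))" using m by simp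
        also have "\<dots> \<le> \<theta> / m * after_gain x z"
          using ag(1) m Suc.prems by (intro mult_left_mono) auto
        finally have "P - exp (- (\<theta> * (x - t))) \<le> P - exp (- (\<theta> / m * after_gain x z))"
          by simp
        also have "\<dots> \<le> survival_upto n (after_gain x z)"
          unfolding P_def using Suc.IH[OF ag(2), of "\<theta> / m"] m Suc.prems by simp
        finally have le: "P - exp (- (\<theta> * (x - t))) \<le> survival_upto n (after_gain x z)" .
        have "exp (- (\<theta> * t)) * (P - exp (- (\<theta> * (x - t)))) \<le> exp (- (\<theta> * t)) * survival_upto n (after_gain x z)"
          by (rule mult_left_mono[OF le]) simp
        \<comment> \<open>The discount factor is dropped from a nonnegative quantity.\<close>
        also have "\<dots> \<le> survival_upto n (after_gain x z)"
          using Suc.prems t survival_upto_bounds(1) by (intro mult_left_le_one_le) auto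
        finally show ?thesis
          using True unfolding e by (simp add: t_def P_def m_def right_diff_distrib)
      qed
    qed
  qed
  finally show ?case by (simp add: survival_upto_Suc)
qed

lemma survival_ge:
  assumes "0 \<le> x" "0 < \<theta>"
  shows "damping_lim \<theta> - exp (- (\<theta> * x)) \<le> survival x"
  by (rule LIMSEQ_le[OF tendsto_diff[OF damping_LIMSEQ[OF assms(2)] tendsto_const] survival_upto_LIMSEQ])
    (use survival_upto_ge[OF assms] in auto)

text \<open>The ruin probability averaged over an exponential initial capital of rate x, hence a
  number in [0,1]; the r of the overview.\<close>

definition ruin_avg :: "real \<Rightarrow> real" where
  "ruin_avg x = x * Re (\<rho> (of_real x))"

lemma Re_rho_eq:
  assumes "0 < Re s"
  shows "\<rho> (of_real (Re s)) = of_real (\<integral>x. norm (decay s x) * (1 - survival x) \<partial>lborel)"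
  unfolding rho_eq_decay integral_complex_of_real[symmetric]
  by (intro Bochner_Integration.integral_cong refl) (auto simp: norm_decay decay_def indicator_def exp_of_real[symmetric])

lemma integrable_decay_ruin:
  assumes "0 < Re s"
  shows "integrable lborel (\<lambda>x. norm (decay s x) * (1 - survival x))"
  by (rule Bochner_Integration.integrable_bound[OF integrable_norm_decay[OF assms]])
    (use survival_bounds in \<open>auto intro!: mult_left_le AE_I2\<close>)

lemma norm_rho_le_ruin_avg:
  assumes "0 < Re s"
  shows "norm (\<rho> s) \<le> ruin_avg (Re s) / Re s"
proof -
  have "norm (\<rho> s) \<le> (\<integral>x. norm (decay s x) * (1 - survival x) \<partial>lborel)"
    unfolding rho_eq_decay
  proof (rule Bochner_Integration.integral_norm_bound_integral)
    have *: "norm (decay s x * of_real (1 - survival x)) = norm (decay s x) * (1 - survival x)" for x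
      using survival_bounds[of x] unfolding norm_mult norm_of_real by simp
    then show "norm (decay s x * of_real (1 - survival x)) \<le> norm (decay s x) * (1 - survival x)" for x
      by simp
    show "integrable lborel (\<lambda>x. decay s x * of_real (1 - survival x))"
      by (rule Bochner_Integration.integrable_bound[OF integrable_decay_ruin[OF assms]])
        (use * in \<open>auto intro!: AE_I2\<close>)
  qed (rule integrable_decay_ruin[OF assms])
  then show ?thesis
    using assms unfolding ruin_avg_def Re_rho_eq[OF assms] by simp
qed

lemma unit_valued_ruin_avg: "unit_valued ruin_avg"
  unfolding unit_valued_def
proof (intro conjI allI impI)
  show "ruin_avg \<in> borel_measurable borel"
    unfolding ruin_avg_def[abs_def] by measurable
  fix x :: real assume x: "0 < x"
  have "0 \<le> ruin_avg x / x"
    using norm_rho_le_ruin_avg[of "of_real x"] x order_trans[OF norm_ge_zero] by fastforce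
  then show "0 \<le> ruin_avg x" using x by (simp add: zero_le_divide_iff)
  have "Re (\<rho> (of_real x)) \<le> 1 / x"
    using norm_rho_le[of "of_real x"] x complex_Re_le_cmod[of "\<rho> (of_real x)"] by simp
  then show "ruin_avg x \<le> 1"
    using x by (simp add: ruin_avg_def field_simps)
qed

text \<open>Averaging 1 - survival y \<le> 1 - D(\<theta>) + exp(-\<theta> y) over an exponential y
  of rate x gives x/(x+\<theta>) for the last term. It is relaxed to x/\<theta>, since a linear term
  shrinks under \<open>averaging\<close>.\<close>

lemma ruin_avg_le:
  assumes x: "0 < x" and \<theta>: "0 < \<theta>"
  shows "ruin_avg x \<le> (1 - damping_lim \<theta>) + x / \<theta>"
proof -
  have i1: "has_bochner_integral lborel (\<lambda>y. norm (decay (of_real x) y)) (1 / x)"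
    using has_bochner_integral_norm_decay[of "of_real x"] x by simp
  have i2: "has_bochner_integral lborel (\<lambda>y. norm (decay (of_real (x + \<theta>)) y)) (1 / (x + \<theta>))"
    using has_bochner_integral_norm_decay[of "of_real (x + \<theta>)"] x \<theta> by simp
  have i3: "has_bochner_integral lborel (\<lambda>y. (1 - damping_lim \<theta>) * norm (decay (of_real x) y) + norm (decay (of_real (x + \<theta>)) y))
      ((1 - damping_lim \<theta>) * (1 / x) + 1 / (x + \<theta>))"
    by (intro has_bochner_integral_add has_bochner_integral_mult_right i1 i2)
  have "ruin_avg x / x = (\<integral>y. norm (decay (of_real x) y) * (1 - survival y) \<partial>lborel)"
    using x Re_rho_eq[of "of_real x"] by (simp add: ruin_avg_def)
  also have "\<dots> \<le> (\<integral>y. (1 - damping_lim \<theta>) * norm (decay (of_real x) y) + norm (decay (of_real (x + \<theta>)) y) \<partial>lborel)"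
  proof (rule integral_mono)
    fix y
    show "norm (decay (of_real x) y) * (1 - survival y) \<le>
        (1 - damping_lim \<theta>) * norm (decay (of_real x) y) + norm (decay (of_real (x + \<theta>)) y)"
    proof (cases "0 \<le> y")
      case True
      have "norm (decay (of_real x) y) * (1 - survival y) \<le>
          norm (decay (of_real x) y) * (1 - damping_lim \<theta> + exp (- (\<theta> * y)))"
        using survival_ge[OF True \<theta>] by (intro mult_left_mono) auto
      moreover have "norm (decay (of_real x) y) * exp (- (\<theta> * y)) = norm (decay (of_real (x + \<theta>)) y)"
        by (simp add: norm_decay exp_add[symmetric] algebra_simps)
      ultimately show ?thesis
        by (simp add: distrib_left mult.commute)
    qed (simp add: norm_decay)
  qed (use i3 integrable_decay_ruin[of "of_real x"] x in \<open>auto simp: has_bochner_integral_iff\<close>)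
  also have "\<dots> = (1 - damping_lim \<theta>) * (1 / x) + 1 / (x + \<theta>)"
    using i3 by (rule has_bochner_integral_integral_eq)
  finally have "ruin_avg x \<le> (1 - damping_lim \<theta>) + x / (x + \<theta>)"
    using x by (simp add: field_simps)
  also have "x / (x + \<theta>) \<le> x / \<theta>"
    using x \<theta> by (intro divide_left_mono) auto
  finally show ?thesis by simp
qed

text \<open>Constants do not grow because phi \<le> 1, while each division of the argument by 1 + w
  \<ge> 1 + a contracts the linear part.\<close>

lemma averaging_funpow_linear_bound:
  assumes g: "unit_valued g" and le: "\<And>x. 0 < x \<Longrightarrow> g x \<le> \<epsilon> + K * x" and nn: "0 \<le> \<epsilon>" "0 \<le> K" and x: "0 < x"
  shows "(averaging ^^ n) g x \<le> \<epsilon> + K * x / (1 + a) ^ n"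
  using x
proof (induction n arbitrary: x)
  case (Suc n)
  let ?g = "(averaging ^^ n) g" and ?B = "\<epsilon> + K * x / (1 + a) ^ Suc n"
  have B0: "0 \<le> ?B" using nn Suc.prems a_pos by simp
  have "(LBINT w:{a..b}. ?g (x / (1 + w))) \<le> (LBINT w:{a..b}. ?B)"
  proof (rule set_integral_mono)
    show "set_integrable lborel {a..b} (\<lambda>w. ?g (x / (1 + w)))"
      by (intro averaging_integrable unit_valued_funpow g Suc.prems)
    show "set_integrable lborel {a..b} (\<lambda>w. ?B)"
      by (rule set_integrable_bounded[where B="norm ?B"]) (auto simp: emeasure_lborel_Icc_eq)
    fix w assume w: "w \<in> {a..b}"
    have "?g (x / (1 + w)) \<le> \<epsilon> + K * (x / (1 + w)) / (1 + a) ^ n"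
      using Suc.prems w a_pos by (intro Suc.IH) simp
    also have "K * (x / (1 + w)) / (1 + a) ^ n \<le> K * (x / (1 + a)) / (1 + a) ^ n"
      using w a_pos nn Suc.prems by (intro divide_right_mono mult_left_mono divide_left_mono) auto
    finally show "?g (x / (1 + w)) \<le> ?B" by simp
  qed
  also have "\<dots> = (b - a) * ?B"
    using a_less_b by (simp add: set_lebesgue_integral_def)
  finally have "averaging ?g x \<le> phi_real x / (b - a) * ((b - a) * ?B)"
    unfolding averaging_def using phi_real_nonneg[OF Suc.prems] a_less_b by (intro mult_left_mono) auto
  also have "\<dots> = phi_real x * ?B"
    using a_less_b by simp
  also have "\<dots> \<le> 1 * ?B"
    using phi_real_le_1[OF Suc.prems] B0 by (rule mult_right_mono)
  finally show ?case by simp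
qed (use le in simp)

lemma averaging_ruin_LIMSEQ:
  assumes x: "0 < x"
  shows "(\<lambda>n. (averaging ^^ n) ruin_avg x) \<longlonglongrightarrow> 0"
proof (cases "\<exists>x>0. damping_lim x \<noteq> 0")
  case False
  then have "damping_lim x = 0" using x by auto
  then have "(\<lambda>n. damping n x) \<longlonglongrightarrow> 0" using damping_LIMSEQ[OF x] by simp
  moreover have "(averaging ^^ n) ruin_avg x \<le> damping n x" for n
    unfolding damping_def using unit_valued_ruin_avg x
    by (intro averaging_funpow_mono unit_valued_one) (auto simp: unit_valued_def)
  moreover have "0 \<le> (averaging ^^ n) ruin_avg x" for n
    using unit_valued_funpow[OF unit_valued_ruin_avg, of n] x by (auto simp: unit_valued_def)
  ultimately show ?thesis
    using tendsto_sandwich[of "\<lambda>_. 0" "\<lambda>n. (averaging ^^ n) ruin_avg x" sequentially "\<lambda>n. damping n x" 0] by simp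
next
  case True
  show ?thesis
  proof (rule LIMSEQ_I)
    fix e :: real assume e: "0 < e"
    \<comment> \<open>This choice keeps the constant part of \<open>ruin_avg_le\<close> below e/2.
      The slope 1/\<theta> may be huge, but it is fixed while n grows.\<close>
    obtain \<theta> where \<theta>: "0 < \<theta>" "1 - e / 2 < damping_lim \<theta>"
      using damping_lim_dichotomy[OF True, of "e / 2"] e by auto
    have bnd: "(averaging ^^ n) ruin_avg x \<le> e / 2 + 1 / \<theta> * x / (1 + a) ^ n" for n
    proof (rule averaging_funpow_linear_bound[OF unit_valued_ruin_avg _ _ _ x])
      show "ruin_avg y \<le> e / 2 + 1 / \<theta> * y" if "0 < y" for y
      proof -
        have "ruin_avg y \<le> (1 - damping_lim \<theta>) + y / \<theta>" by (rule ruin_avg_le[OF that \<theta>(1)])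
        also have "\<dots> \<le> e / 2 + y / \<theta>" using \<theta>(2) by simp
        finally show ?thesis by simp
      qed
    qed (use e \<theta>(1) in simp_all)
    have "(\<lambda>n. 1 / \<theta> * x / (1 + a) ^ n) \<longlonglongrightarrow> 0"
      using a_pos by (intro LIMSEQ_divide_realpow_zero) simp
    from LIMSEQ_D[OF this half_gt_zero[OF e]]
    obtain N where N: "\<And>n. N \<le> n \<Longrightarrow> norm (1 / \<theta> * x / (1 + a) ^ n - 0) < e / 2"
      by blast
    show "\<exists>N. \<forall>n\<ge>N. norm ((averaging ^^ n) ruin_avg x - 0) < e"
    proof (intro exI allI impI)
      fix n assume "N \<le> n"
      have "0 \<le> (averaging ^^ n) ruin_avg x"
        using unit_valued_funpow[OF unit_valued_ruin_avg] x unfolding unit_valued_def by blast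
      then show "norm ((averaging ^^ n) ruin_avg x - 0) < e"
        using N[OF \<open>N \<le> n\<close>] bnd[of n] unfolding real_norm_def by linarith
    qed
  qed
qed

end

section \<open>The iterated integrals\<close>

lemma growth_0 [simp]: "growth 0 v = 1"
  by (simp add: growth_def)

lemma growth_Suc: "growth (Suc j) v = growth j v * (1 + v (Suc j))"
  by (simp add: growth_def atLeastAtMostSuc_conv mult.commute)

lemma growth_upd [simp]: "growth j (v(Suc j := w)) = growth j v"
  unfolding growth_def by (intro prod.cong) auto

lemma growth_bounds:
  assumes "v \<in> {1..j} \<rightarrow> {a..b}" "-1 < a"
  shows "(1 + a) ^ j \<le> growth j v" "growth j v \<le> (1 + b) ^ j"
proof -
  have v: "a \<le> v m \<and> v m \<le> b" if "m \<in> {1..j}" for m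
    using assms(1) that by (auto simp: Pi_iff)
  have "(\<Prod>m\<in>{1..j}. 1 + a) \<le> growth j v"
    unfolding growth_def using v assms(2) by (intro prod_mono) auto
  then show "(1 + a) ^ j \<le> growth j v" by simp
  have "growth j v \<le> (\<Prod>m\<in>{1..j}. 1 + b)"
    unfolding growth_def using v assms(2) by (intro prod_mono) (auto intro: order_trans[of 0 "1 + a"])
  then show "growth j v \<le> (1 + b) ^ j" by simp
qed

lemma growth_ge_1:
  assumes "v \<in> {1..j} \<rightarrow> {a..b}" "0 < a"
  shows "1 \<le> growth j v"
  by (rule order_trans[OF one_le_power growth_bounds(1)[OF assms(1)]]) (use assms(2) in auto)

lemma kernel_prod_0 [simp]: "kernel_prod \<phi> \<mu> a b s 0 v = 1"
  by (simp add: kernel_prod_def)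

lemma kernel_prod_Suc:
  "kernel_prod \<phi> \<mu> a b s (Suc j) v =
    kernel_prod \<phi> \<mu> a b s j v * kernel_k \<phi> \<mu> a b (s / of_real (growth j v)) (v (Suc j))"
  by (simp add: kernel_prod_def atLeastAtMostSuc_conv mult.commute)

lemma kernel_prod_upd [simp]: "kernel_prod \<phi> \<mu> a b s j (v(Suc j := w)) = kernel_prod \<phi> \<mu> a b s j v"
proof -
  have "growth (i - 1) (v(Suc j := w)) = growth (i - 1) v" if "i \<in> {1..j}" for i
    unfolding growth_def using that by (intro prod.cong) auto
  then show ?thesis
    unfolding kernel_prod_def by (intro prod.cong) auto
qed

lemma Pi_upd_Suc:
  "v \<in> {1..n} \<rightarrow> A \<Longrightarrow> w \<in> A \<Longrightarrow> v(Suc n := w) \<in> {1..Suc n} \<rightarrow> A"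
  by (auto simp: Pi_iff le_Suc_eq)

section \<open>Measurability and iterated integration on cubes\<close>

abbreviation "cube_measure \<equiv> \<lambda>j::nat. Pi\<^sub>M {1..j} (\<lambda>_. lborel :: real measure)"
abbreviation "cube \<equiv> \<lambda>a b. \<lambda>j::nat. {1..j} \<rightarrow>\<^sub>E {a..b::real}"

lemma component_measurable: "i \<in> {1..j} \<Longrightarrow> (\<lambda>v. v i) \<in> borel_measurable (cube_measure j)"
  using measurable_component_singleton[of i "{1..j}" "\<lambda>_. lborel :: real measure"] by simp

lemma growth_measurable: "m \<le> j \<Longrightarrow> growth m \<in> borel_measurable (cube_measure j)"
  unfolding growth_def[abs_def]
  by (intro borel_measurable_prod borel_measurable_add borel_measurable_const component_measurable) auto

lemma growth_measurable' [measurable]: "growth j \<in> borel_measurable (cube_measure j)"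
  by (rule growth_measurable) simp

lemma kernel_k_measurable [measurable (raw)]:
  assumes [measurable]: "\<phi> \<in> borel_measurable borel" "f \<in> borel_measurable N" "g \<in> borel_measurable N"
  shows "(\<lambda>x. kernel_k \<phi> \<mu> a b (f x) (g x)) \<in> borel_measurable N"
  unfolding kernel_k_def by measurable

lemma kernel_prod_measurable [measurable]:
  assumes [measurable]: "\<phi> \<in> borel_measurable borel"
  shows "kernel_prod \<phi> \<mu> a b s j \<in> borel_measurable (cube_measure j)"
  unfolding kernel_prod_def[abs_def]
proof (intro borel_measurable_prod)
  fix i assume i: "i \<in> {1..j}"
  have [measurable]: "growth (i - 1) \<in> borel_measurable (cube_measure j)" "(\<lambda>v. v i) \<in> borel_measurable (cube_measure j)"
    using i by (auto simp del: One_nat_def intro: growth_measurable component_measurable)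
  show "(\<lambda>v. kernel_k \<phi> \<mu> a b (s / of_real (growth (i - 1) v)) (v i)) \<in> borel_measurable (cube_measure j)"
    by measurable
qed

interpretation lborel_product: product_sigma_finite "\<lambda>_::nat. lborel :: real measure"
  by (simp add: product_sigma_finite_def lborel.sigma_finite_measure_axioms)

lemma cube_sets [measurable]: "cube a b j \<in> sets (cube_measure j)"
  by (intro sets_PiM_I_finite) auto

lemma emeasure_cube: "emeasure (cube_measure j) (cube a b j) < \<infinity>"
proof -
  have "emeasure (cube_measure j) (cube a b j) = (\<Prod>i\<in>{1..j}. emeasure lborel {a..b})"
    by (intro lborel_product.emeasure_PiM) auto
  then show ?thesis
    by (simp add: emeasure_lborel_Icc_eq ennreal_power power_less_top_ennreal less_top[symmetric])
qed

lemma cube_integrable_bounded: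
  fixes g :: "_ \<Rightarrow> _ :: {banach, second_countable_topology}"
  assumes "g \<in> borel_measurable (cube_measure j)" "\<And>v. v \<in> {1..j} \<rightarrow> {a..b} \<Longrightarrow> norm (g v) \<le> B"
  shows "set_integrable (cube_measure j) (cube a b j) g"
  using assms by (intro set_integrable_bounded[where B=B] cube_sets emeasure_cube) (auto simp: PiE_iff Pi_iff)

text \<open>Fubini with the last coordinate innermost. \<open>K\<close> and \<open>growth\<close> of
  order j do not see that coordinate, so they leave the inner integral.\<close>

lemma cube_integral_Suc:
  fixes g :: "_ \<Rightarrow> _ :: {banach, second_countable_topology}"
  assumes "set_integrable (cube_measure (Suc j)) (cube a b (Suc j)) g"
  shows "(LINT v:cube a b (Suc j)|cube_measure (Suc j). g v) =
    (LINT v:cube a b j|cube_measure j. (LBINT w:{a..b}. g (v(Suc j := w))))"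
proof -
  have ins: "{1..Suc j} = insert (Suc j) {1..j}" by auto
  \<comment> \<open>Membership in the space makes v extensional; without it the updated function
    need not lie in the extensional cube.\<close>
  have ind: "indicator (cube a b (Suc j)) (v(Suc j := w)) = (indicator (cube a b j) v * indicator {a..b} w :: real)"
    if "v \<in> space (cube_measure j)" for v w
    using that by (auto simp: indicator_def space_PiM PiE_iff extensional_def le_Suc_eq split: if_splits)
  have "(LINT v:cube a b (Suc j)|cube_measure (Suc j). g v) =
      (\<integral>v. \<integral>w. indicator (cube a b (Suc j)) (v(Suc j := w)) *\<^sub>R g (v(Suc j := w)) \<partial>lborel \<partial>cube_measure j)"
    using assms unfolding set_lebesgue_integral_def set_integrable_def ins
    by (intro lborel_product.product_integral_insert) auto
  also have "\<dots> = (LINT v:cube a b j|cube_measure j. (LBINT w:{a..b}. g (v(Suc j := w))))"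
    unfolding set_lebesgue_integral_def
    by (intro Bochner_Integration.integral_cong refl) (simp only: ind scaleR_scaleR[symmetric] integral_scaleR_right)
  finally show ?thesis .
qed

text \<open>The only point of the empty product is the function that is \<open>undefined\<close>
  everywhere.\<close>

lemma cube_integral_0: "cube_integral a b 0 g = g (\<lambda>_. undefined)"
  by (simp add: cube_integral_def set_lebesgue_integral_def PiM_empty lebesgue_integral_count_space_finite)

lemma norm_set_integral_le:
  fixes h :: "real \<Rightarrow> 'b::{banach, second_countable_topology}"
  assumes "a \<le> b" "0 \<le> B" "\<And>w. w \<in> {a..b} \<Longrightarrow> norm (h w) \<le> B"
  shows "norm (LBINT w:{a..b}. h w) \<le> B * (b - a)"
proof -
  have "norm (LBINT w:{a..b}. h w) \<le> (\<integral>w. norm (indicator {a..b} w *\<^sub>R h w) \<partial>lborel)"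
    unfolding set_lebesgue_integral_def by (rule integral_norm_bound)
  also have "\<dots> \<le> (\<integral>w. indicator {a..b} w * B \<partial>lborel)"
  proof (rule integral_mono')
    show "integrable lborel (\<lambda>w. indicator {a..b} w * B)"
      by (intro integrable_mult_left integrable_real_indicator) (auto simp: emeasure_lborel_Icc_eq)
  qed (use assms in \<open>auto simp: indicator_def\<close>)
  also have "\<dots> = B * (b - a)"
    using assms by simp
  finally show ?thesis .
qed

text \<open>From 1 + u \<le> exp u and the geometric series with ratio 1/(1+a), whose sum is
  (1+a)/a.\<close>

lemma prod_one_plus_geometric_le:
  fixes q a :: real
  assumes "0 \<le> q" "0 < a"
  shows "(\<Prod>i<n. 1 + q / (1 + a) ^ i) \<le> exp (q * (1 + a) / a)"
proof -
  have "(\<Prod>i<n. 1 + q / (1 + a) ^ i) \<le> (\<Prod>i<n. exp (q / (1 + a) ^ i))"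
    using assms by (intro prod_mono) (auto intro!: add_nonneg_nonneg)
  also have "\<dots> = exp (q * (\<Sum>i<n. (1 / (1 + a)) ^ i))"
    by (simp add: exp_sum sum_distrib_left power_one_over)
  also have "(\<Sum>i<n. (1 / (1 + a)) ^ i) \<le> (\<Sum>i. (1 / (1 + a)) ^ i)"
    using assms by (intro sum_le_suminf summable_geometric) auto
  also have "\<dots> = (1 + a) / a"
    using assms by (subst suminf_geometric) (auto simp: field_simps)
  finally show ?thesis
    using assms by (simp add: mult_left_mono)
qed

section \<open>Uniform estimates away from the poles\<close>

context dual_risk_model
begin

abbreviation "K \<equiv> kernel_prod \<phi> \<mu> a b"
abbreviation "L \<equiv> source_L \<phi> \<rho> \<mu> a b"

text \<open>Makes \<open>pole_free\<close> quantitative. For each n a compactness argument gives a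
  positive distance; for large n the point s/pi_n is so small that the distance is at least mu/2, so
  only finitely many n matter.\<close>

lemma pole_distance:
  assumes pole: "pole_free \<mu> a b s"
  shows "\<exists>\<delta>>0. \<forall>n. \<forall>v\<in>{1..n} \<rightarrow> {a..b}. \<forall>w\<in>{a..b}.
    \<delta> \<le> norm (of_real (\<mu> * (1 + w)) - s / of_real (growth n v))"
proof -
  define P where "P \<delta> n \<longleftrightarrow> (\<forall>v\<in>{1..n} \<rightarrow> {a..b}. \<forall>w\<in>{a..b}.
    \<delta> \<le> norm (of_real (\<mu> * (1 + w)) - s / of_real (growth n v)))" for \<delta> n
  have one: "\<exists>\<delta>>0. P \<delta> n" for n
  proof -
    let ?A = "(\<lambda>w. of_real (\<mu> * (1 + w)) :: complex) ` {a..b}"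
    \<comment> \<open>The growth factor is replaced by one real parameter ranging over an interval,
      so that compactness is used in one dimension.\<close>
    let ?Z = "(\<lambda>\<gamma>. s / of_real \<gamma>) ` {(1 + a) ^ n..(1 + b) ^ n}"
    have pow: "0 < (1 + a) ^ n" using a_pos by simp
    have "compact ?A"
      by (intro compact_continuous_image continuous_intros) auto
    moreover have "closed ?Z"
    proof (intro compact_imp_closed compact_continuous_image continuous_intros ballI)
      fix \<gamma> assume "\<gamma> \<in> {(1 + a) ^ n..(1 + b) ^ n}"
      then have "0 < \<gamma>" using pow by auto
      then show "complex_of_real \<gamma> \<noteq> 0" by simp
    qed auto
    moreover have "?A \<inter> ?Z = {}"
    proof (rule ccontr)
      assume "?A \<inter> ?Z \<noteq> {}"
      then obtain p where "p \<in> ?A" "p \<in> ?Z" by blast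
      then obtain w \<gamma> where w: "w \<in> {a..b}" and "\<gamma> \<in> {(1 + a) ^ n..(1 + b) ^ n}"
        and eq: "of_real (\<mu> * (1 + w)) = s / of_real \<gamma>" by blast
      then have \<gamma>: "(1 + a) ^ n \<le> \<gamma>" "\<gamma> \<le> (1 + b) ^ n" by simp_all
      have \<gamma>0: "0 < \<gamma>" using \<gamma>(1) pow by linarith
      \<comment> \<open>A collision would give s = mu \<gamma> (1 + w). The constant vector with
        entry c has growth (1 + c)^(n+1) = \<gamma> (1 + w), so \<open>pole_free\<close> would fail
        at that point of the cube.\<close>
      define c where "c = root (Suc n) (\<gamma> * (1 + w)) - 1"
      have lo: "(1 + a) ^ Suc n \<le> \<gamma> * (1 + w)"
        using \<gamma>(1) w a_pos \<gamma>0 by (simp add: mult.commute[of "1 + a"] mult_mono)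
      have hi: "\<gamma> * (1 + w) \<le> (1 + b) ^ Suc n"
        using \<gamma>(2) w a_pos \<gamma>0 by (simp add: mult.commute[of "1 + b"] mult_mono)
      have "1 + a = root (Suc n) ((1 + a) ^ Suc n)"
        by (rule real_root_power_cancel[symmetric]) (use a_pos in auto)
      also have "\<dots> \<le> root (Suc n) (\<gamma> * (1 + w))"
        by (rule real_root_le_mono[OF zero_less_Suc lo])
      finally have "1 + a \<le> root (Suc n) (\<gamma> * (1 + w))" .
      moreover have "root (Suc n) (\<gamma> * (1 + w)) \<le> root (Suc n) ((1 + b) ^ Suc n)"
        by (rule real_root_le_mono[OF zero_less_Suc hi])
      moreover have "root (Suc n) ((1 + b) ^ Suc n) = 1 + b"
        by (rule real_root_power_cancel) (use a_pos a_less_b in auto)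
      ultimately have c: "c \<in> {a..b}"
        unfolding c_def atLeastAtMost_iff by linarith
      have "growth (Suc n) (\<lambda>_. c) = (1 + c) ^ Suc n"
        by (simp add: growth_def)
      also have "\<dots> = \<gamma> * (1 + w)"
        unfolding c_def using \<gamma>0 w a_pos real_root_pow_pos2[of "Suc n" "\<gamma> * (1 + w)"] by simp
      finally have "complex_of_real (\<mu> * growth (Suc n) (\<lambda>_. c)) = of_real (\<mu> * (1 + w)) * of_real \<gamma>"
        by (simp add: mult_ac)
      also have "\<dots> = s"
        unfolding eq using \<gamma>0 by simp
      finally show False
        using pole c unfolding pole_free_def by (metis Pi_I One_nat_def Suc_leI zero_less_Suc)
    qed
    ultimately obtain d where d: "0 < d" "\<And>x y. x \<in> ?A \<Longrightarrow> y \<in> ?Z \<Longrightarrow> d \<le> dist x y"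
      using separate_compact_closed[of ?A ?Z] by blast
    have "P d n"
      unfolding P_def dist_norm[symmetric] using growth_bounds[of _ n a b] a_pos
      by (intro ballI d(2) imageI) auto
    with d(1) show ?thesis by blast
  qed
  have finite: "\<exists>\<delta>>0. \<forall>n<N. P \<delta> n" for N
  proof (induction N)
    case (Suc N)
    then obtain d where d: "0 < d" "\<forall>n<N. P d n" by blast
    obtain e where e: "0 < e" "P e N" using one by blast
    have "\<forall>n<Suc N. P (min d e) n"
      using d(2) e(2) unfolding P_def less_Suc_eq by (meson min.cobounded1 min.cobounded2 order_trans)
    with d(1) e(1) show ?case by (intro exI[of _ "min d e"]) auto
  qed (auto intro: zero_less_one)
  \<comment> \<open>From N on, the norm of s/pi_n is below mu/2, while mu (1 + w) is at least
    mu.\<close>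
  obtain N where N: "norm s / (\<mu> / 2) < (1 + a) ^ N"
    using real_arch_pow[of "1 + a"] a_pos by auto
  obtain d where d: "0 < d" "\<forall>n<N. P d n" using finite by blast
  have "P (min d (\<mu> / 2)) n" for n
  proof (cases "n < N")
    case True
    then show ?thesis using d(2) unfolding P_def by (meson min.cobounded1 order_trans)
  next
    case False
    show ?thesis unfolding P_def
    proof (intro ballI)
      fix v w assume v: "v \<in> {1..n} \<rightarrow> {a..b}" and w: "w \<in> {a..b}"
      have g: "(1 + a) ^ N \<le> growth n v"
        by (rule order_trans[OF power_increasing growth_bounds(1)[OF v]]) (use a_pos False in auto)
      have g0: "0 < growth n v" using growth_ge_1[OF v a_pos] by simp
      have "norm s < \<mu> / 2 * growth n v"
        using N g mu_pos by (simp add: field_simps) (smt (verit) mult_left_mono)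
      then have "norm (s / of_real (growth n v)) < \<mu> / 2"
        using g0 by (simp add: norm_divide field_simps)
      moreover have "\<mu> \<le> norm (of_real (\<mu> * (1 + w)) :: complex)"
        unfolding norm_of_real using mu_pos w a_pos by (simp add: distrib_left)
      moreover have "norm (of_real (\<mu> * (1 + w)) :: complex) - norm (s / of_real (growth n v)) \<le>
          norm (of_real (\<mu> * (1 + w)) - s / of_real (growth n v))"
        by (rule norm_triangle_ineq2)
      ultimately show "min d (\<mu> / 2) \<le> norm (of_real (\<mu> * (1 + w)) - s / of_real (growth n v))"
        by linarith
    qed
  qed
  then show ?thesis
    using d(1) mu_pos unfolding P_def by (intro exI[of _ "min d (\<mu> / 2)"]) auto
qed

context
  fixes s :: complex
  assumes s: "0 < Re s" and pole: "pole_free \<mu> a b s"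
begin

definition pole_dist :: real where
  "pole_dist = (SOME \<delta>. 0 < \<delta> \<and> (\<forall>n. \<forall>v\<in>{1..n} \<rightarrow> {a..b}. \<forall>w\<in>{a..b}.
    \<delta> \<le> norm (of_real (\<mu> * (1 + w)) - s / of_real (growth n v))))"

text \<open>Bounds mu (1 + w) / |mu (1 + w) - z| for z = s/pi_n: the quotient is at most 1 +
  |z|/\<open>pole_dist\<close>, and |z| is at most |s|/(1+a)^n.\<close>

definition corr :: "nat \<Rightarrow> real" where
  "corr n = 1 + norm s / pole_dist / (1 + a) ^ n"

lemma pole_dist:
  shows "0 < pole_dist"
    and "v \<in> {1..n} \<rightarrow> {a..b} \<Longrightarrow> w \<in> {a..b} \<Longrightarrow>
      pole_dist \<le> norm (of_real (\<mu> * (1 + w)) - s / of_real (growth n v))"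
  using someI_ex[OF pole_distance[OF pole]] unfolding pole_dist_def by blast+

lemma corr_nonneg: "0 \<le> corr n"
  using pole_dist(1) a_pos by (simp add: corr_def)

lemma scaled_pos:
  assumes "v \<in> {1..n} \<rightarrow> {a..b}"
  shows "0 < Re (s / of_real (growth n v))" "0 < growth n v" "Re (s / of_real (growth n v)) = Re s / growth n v"
    "w \<in> {a..b} \<Longrightarrow> s / of_real (growth n v) \<noteq> of_real (\<mu> * (1 + w))"
  using growth_ge_1[OF assms a_pos] s pole_dist(2)[OF assms, of w] pole_dist(1)
  by (auto simp: Re_divide_of_real)

text \<open>The weight 1 + w meets the numerator mu of the kernel, leaving a quotient close to 1.
  The same weights multiply to the growth factor that bounds \<open>\<rho>\<close> at the scaled
  point.\<close>

lemma norm_kernel_le: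
  assumes v: "v \<in> {1..n} \<rightarrow> {a..b}" and w: "w \<in> {a..b}"
  shows "norm (kernel_k \<phi> \<mu> a b (s / of_real (growth n v)) w) * (1 + w) \<le>
    phi_real (Re s / growth n v) / (b - a) * corr n"
proof -
  define z where "z = s / of_real (growth n v)"
  define d where "d = norm (of_real (\<mu> * (1 + w)) - z)"
  have d: "pole_dist \<le> d" "0 < d"
    using pole_dist(2)[OF v w] pole_dist(1) by (auto simp: d_def z_def)
  have "norm z \<le> norm s / (1 + a) ^ n"
    unfolding z_def using growth_bounds(1)[OF v] a_pos scaled_pos(2)[OF v]
    by (simp add: norm_divide divide_left_mono)
  then have zd: "norm z / d \<le> norm s / (1 + a) ^ n / pole_dist"
    using d pole_dist(1) a_pos by (intro frac_le) auto
  have "\<mu> * (1 + w) = norm (of_real (\<mu> * (1 + w)) :: complex)"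
    unfolding norm_of_real using mu_pos w a_pos by simp
  also have "\<dots> \<le> d + norm z"
    using norm_triangle_sub[of "of_real (\<mu> * (1 + w))" z] by (simp add: d_def add.commute)
  finally have "\<mu> * (1 + w) / d \<le> (d + norm z) / d"
    using d by (intro divide_right_mono) auto
  also have "\<dots> = 1 + norm z / d"
    using d by (simp add: add_divide_distrib)
  also have "\<dots> \<le> corr n"
    using zd by (simp add: corr_def divide_divide_eq_left mult.commute)
  finally have c: "\<mu> * (1 + w) / d \<le> corr n" .
  have "norm (kernel_k \<phi> \<mu> a b z w) * (1 + w) = norm (\<phi> z) / (b - a) * (\<mu> * (1 + w) / d)"
    using a_less_b mu_pos by (simp add: kernel_k_def norm_mult norm_divide d_def flip: of_real_diff)
  also have "\<dots> \<le> phi_real (Re z) / (b - a) * corr n"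
    using norm_phi_le_real[of z] scaled_pos(1)[OF v] a_less_b c d mu_pos w a_pos phi_real_nonneg[of "Re z"]
    by (intro mult_mono divide_right_mono) (auto simp: z_def)
  finally show ?thesis
    using scaled_pos(3)[OF v] by (simp add: z_def)
qed

lemma norm_kernel_le_const:
  assumes v: "v \<in> {1..n} \<rightarrow> {a..b}" and w: "w \<in> {a..b}"
  shows "norm (kernel_k \<phi> \<mu> a b (s / of_real (growth n v)) w) \<le> corr n / (b - a)"
proof -
  have "norm (kernel_k \<phi> \<mu> a b (s / of_real (growth n v)) w) \<le>
      norm (kernel_k \<phi> \<mu> a b (s / of_real (growth n v)) w) * (1 + w)"
    using w a_pos by (simp add: mult_ge1_I distrib_left)
  also have "\<dots> \<le> phi_real (Re s / growth n v) / (b - a) * corr n"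
    by (rule norm_kernel_le[OF v w])
  also have "\<dots> \<le> 1 / (b - a) * corr n"
    using phi_real_le_1[of "Re s / growth n v"] scaled_pos[OF v] a_less_b corr_nonneg s
    by (intro mult_right_mono divide_right_mono) auto
  finally show ?thesis by simp
qed

text \<open>A crude bound that may grow with n; it serves integrability for fixed n only.\<close>

lemma norm_K_le:
  assumes "v \<in> {1..n} \<rightarrow> {a..b}"
  shows "norm (K s n v) \<le> (\<Prod>i<n. corr i / (b - a))"
  using assms
proof (induction n)
  case (Suc n)
  then have v: "v \<in> {1..n} \<rightarrow> {a..b}" "v (Suc n) \<in> {a..b}" by (auto simp: Pi_iff)
  show ?case
    unfolding kernel_prod_Suc norm_mult prod.lessThan_Suc
    using Suc.IH[OF v(1)] norm_kernel_le_const[OF v] corr_nonneg a_less_b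
    by (intro mult_mono) (auto intro!: prod_nonneg divide_nonneg_pos)
qed simp

lemma prod_corr_nonneg: "0 \<le> (\<Prod>i<n. corr i / (b - a))"
  using corr_nonneg a_less_b by (intro prod_nonneg) auto

lemma majorant_integrable:
  assumes g: "unit_valued g"
  shows "set_integrable (cube_measure n) (cube a b n)
    (\<lambda>v. norm (K s n v) * growth n v * g (Re s / growth n v))"
proof (rule cube_integrable_bounded)
  have [measurable]: "g \<in> borel_measurable borel" using g by (simp add: unit_valued_def)
  show "(\<lambda>v. norm (K s n v) * growth n v * g (Re s / growth n v)) \<in> borel_measurable (cube_measure n)"
    by measurable
  fix v assume v: "v \<in> {1..n} \<rightarrow> {a..b}"
  have "0 \<le> g (Re s / growth n v)" "g (Re s / growth n v) \<le> 1"
    using g scaled_pos[OF v] s by (auto simp: unit_valued_def)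
  then have "norm (norm (K s n v) * growth n v * g (Re s / growth n v)) \<le> norm (K s n v) * growth n v"
    using scaled_pos(2)[OF v] by (simp add: abs_mult mult_left_le)
  also have "\<dots> \<le> (\<Prod>i<n. corr i / (b - a)) * (1 + b) ^ n"
    using norm_K_le[OF v] growth_bounds(2)[OF v] a_pos scaled_pos(2)[OF v] prod_corr_nonneg
    by (intro mult_mono) auto
  finally show "norm (norm (K s n v) * growth n v * g (Re s / growth n v)) \<le> (\<Prod>i<n. corr i / (b - a)) * (1 + b) ^ n" .
qed

text \<open>Integrating out the last coordinate replaces g by \<open>averaging g\<close> at the cost
  of one factor \<open>corr n\<close>. The induction hypothesis is then used for
  \<open>averaging g\<close>, which is why g varies.\<close>

lemma majorant_le:
  assumes g: "unit_valued g"
  shows "(LINT v:cube a b n|cube_measure n. norm (K s n v) * growth n v * g (Re s / growth n v)) \<le>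
    (\<Prod>i<n. corr i) * (averaging ^^ n) g (Re s)"
  using g
proof (induction n arbitrary: g)
  case 0
  then show ?case
    by (simp add: set_lebesgue_integral_def PiM_empty lebesgue_integral_count_space_finite)
next
  case (Suc n)
  have [measurable]: "g \<in> borel_measurable borel" using Suc.prems by (simp add: unit_valued_def)
  have uav: "unit_valued (averaging g)" by (rule unit_valued_averaging[OF Suc.prems])
  let ?k = "\<lambda>v w. kernel_k \<phi> \<mu> a b (s / of_real (growth n v)) w"
  let ?I = "\<lambda>v. LBINT w:{a..b}. norm (K s n v * ?k v w) * (growth n v * (1 + w)) * g (Re s / (growth n v * (1 + w)))"
  have inner: "?I v \<le> norm (K s n v) * growth n v * (corr n * averaging g (Re s / growth n v))"
    and inner_nonneg: "0 \<le> ?I v" if v: "v \<in> {1..n} \<rightarrow> {a..b}" for v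
  proof -
    have pos: "0 < growth n v" "0 < Re s / growth n v" using scaled_pos[OF v] s by auto
    have gw: "0 \<le> g (Re s / (growth n v * (1 + w)))" if "w \<in> {a..b}" for w
      using Suc.prems pos s that a_pos by (auto simp: unit_valued_def)
    let ?c = "norm (K s n v) * growth n v * (phi_real (Re s / growth n v) / (b - a) * corr n)"
    have le: "norm (K s n v * ?k v w) * (growth n v * (1 + w)) * g (Re s / (growth n v * (1 + w))) \<le>
        ?c * g (Re s / growth n v / (1 + w))" if w: "w \<in> {a..b}" for w
    proof -
      have "norm (K s n v * ?k v w) * (growth n v * (1 + w)) * g (Re s / (growth n v * (1 + w))) =
          norm (K s n v) * growth n v * (norm (?k v w) * (1 + w)) * g (Re s / growth n v / (1 + w))"
        by (simp add: norm_mult mult_ac)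
      also have "\<dots> \<le> ?c * g (Re s / growth n v / (1 + w))"
        using norm_kernel_le[OF v w] pos gw[OF w] by (intro mult_right_mono mult_left_mono) auto
      finally show ?thesis .
    qed
    have int: "set_integrable lborel {a..b} (\<lambda>w. ?c * g (Re s / growth n v / (1 + w)))"
      by (intro set_integrable_mult_right averaging_integrable Suc.prems pos)
    show "0 \<le> ?I v"
      using gw pos a_pos unfolding set_lebesgue_integral_def
      by (intro integral_nonneg_AE AE_I2) (auto simp: indicator_def)
    have "?I v \<le> (LBINT w:{a..b}. ?c * g (Re s / growth n v / (1 + w)))"
      unfolding set_lebesgue_integral_def
    proof (rule integral_mono')
      fix w
      have c: "0 \<le> ?c"
        using pos corr_nonneg phi_real_nonneg[OF pos(2)] a_less_b by simp
      show "0 \<le> indicator {a..b} w *\<^sub>R (?c * g (Re s / growth n v / (1 + w)))"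
      proof (cases "w \<in> {a..b}")
        case True
        from mult_nonneg_nonneg[OF c gw[OF True]] True show ?thesis
          by (simp only: divide_divide_eq_left indicator_simps scaleR_one)
      qed simp
    qed (use int le in \<open>auto simp: indicator_def set_integrable_def\<close>)
    also have "\<dots> = norm (K s n v) * growth n v * (corr n * averaging g (Re s / growth n v))"
      by (simp add: averaging_def)
    finally show "?I v \<le> norm (K s n v) * growth n v * (corr n * averaging g (Re s / growth n v))" .
  qed
  have "(LINT v:cube a b (Suc n)|cube_measure (Suc n). norm (K s (Suc n) v) * growth (Suc n) v * g (Re s / growth (Suc n) v)) =
      (LINT v:cube a b n|cube_measure n. ?I v)"
    by (subst cube_integral_Suc[OF majorant_integrable[OF Suc.prems]])
      (simp only: kernel_prod_Suc growth_Suc growth_upd kernel_prod_upd fun_upd_same)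
  also have "\<dots> \<le> (LINT v:cube a b n|cube_measure n. corr n * (norm (K s n v) * growth n v * averaging g (Re s / growth n v)))"
    unfolding set_lebesgue_integral_def
  proof (rule integral_mono')
    show "integrable (cube_measure n) (\<lambda>v. indicator (cube a b n) v *\<^sub>R (corr n * (norm (K s n v) * growth n v * averaging g (Re s / growth n v))))"
      using set_integrable_mult_right[OF majorant_integrable[OF uav]] by (simp add: set_integrable_def)
  next
    fix v
    show "indicator (cube a b n) v *\<^sub>R (\<integral>w. indicator {a..b} w *\<^sub>R (norm (K s n v * ?k v w) * (growth n v * (1 + w)) * g (Re s / (growth n v * (1 + w)))) \<partial>lborel)
      \<le> indicator (cube a b n) v *\<^sub>R (corr n * (norm (K s n v) * growth n v * averaging g (Re s / growth n v)))"
    proof (cases "v \<in> cube a b n")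
      case True
      then have "v \<in> {1..n} \<rightarrow> {a..b}" by (simp add: PiE_iff)
      from inner[OF this] show ?thesis
        using True by (simp add: set_lebesgue_integral_def mult_ac)
    qed simp
    show "0 \<le> indicator (cube a b n) v *\<^sub>R (corr n * (norm (K s n v) * growth n v * averaging g (Re s / growth n v)))"
    proof (cases "v \<in> cube a b n")
      case True
      then have v: "v \<in> {1..n} \<rightarrow> {a..b}" by (simp add: PiE_iff)
      have "0 \<le> norm (K s n v) * growth n v * (corr n * averaging g (Re s / growth n v))"
        using inner[OF v] inner_nonneg[OF v] by linarith
      then show ?thesis using True by (simp add: mult_ac)
    qed simp
  qed
  also have "\<dots> = corr n * (LINT v:cube a b n|cube_measure n. norm (K s n v) * growth n v * averaging g (Re s / growth n v))"
    by (rule set_integral_mult_right)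
  also have "\<dots> \<le> corr n * ((\<Prod>i<n. corr i) * (averaging ^^ n) (averaging g) (Re s))"
    by (intro mult_left_mono Suc.IH uav corr_nonneg)
  finally show ?case
    by (simp add: funpow_swap1 mult_ac)
qed

lemma prod_corr_le: "(\<Prod>i<n. corr i) \<le> exp (norm s / pole_dist * (1 + a) / a)"
  unfolding corr_def using pole_dist(1) a_pos by (intro prod_one_plus_geometric_le) auto

section \<open>The remainder and the telescoping series\<close>

lemma K_rho_integrable:
  "set_integrable (cube_measure n) (cube a b n) (\<lambda>v. K s n v * \<rho> (s / of_real (growth n v)))"
proof (rule cube_integrable_bounded)
  fix v assume v: "v \<in> {1..n} \<rightarrow> {a..b}"
  have "norm (\<rho> (s / of_real (growth n v))) \<le> growth n v / Re s"
    using norm_rho_le[OF scaled_pos(1)[OF v]] scaled_pos(3)[OF v] by simp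
  also have "\<dots> \<le> (1 + b) ^ n / Re s"
    using growth_bounds(2)[OF v] a_pos s by (intro divide_right_mono) auto
  finally show "norm (K s n v * \<rho> (s / of_real (growth n v))) \<le> (\<Prod>i<n. corr i / (b - a)) * ((1 + b) ^ n / Re s)"
    unfolding norm_mult using norm_K_le[OF v] prod_corr_nonneg by (intro mult_mono) auto
qed measurable

abbreviation "rho_term n \<equiv> cube_integral a b n (\<lambda>v. K s n v * \<rho> (s / of_real (growth n v)))"
abbreviation "source_term n \<equiv> cube_integral a b n (\<lambda>v. K s n v * L (s / of_real (growth n v)))"

text \<open>The bound r(Re z)/Re z for \<open>\<rho>\<close> at z = s/pi_n produces the weight pi_n
  of the majorant. The product of the \<open>corr i\<close> is bounded, and the iterated averages of
  \<open>ruin_avg\<close> tend to 0.\<close>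

lemma rho_term_LIMSEQ: "rho_term \<longlonglongrightarrow> 0"
proof (rule Lim_null_comparison)
  let ?E = "exp (norm s / pole_dist * (1 + a) / a)"
  show "\<forall>\<^sub>F n in sequentially. norm (rho_term n) \<le> 1 / Re s * (?E * (averaging ^^ n) ruin_avg (Re s))"
  proof (rule always_eventually, rule allI)
    fix n
    have "norm (rho_term n) \<le> (LINT v:cube a b n|cube_measure n. 1 / Re s * (norm (K s n v) * growth n v * ruin_avg (Re s / growth n v)))"
      unfolding cube_integral_def set_lebesgue_integral_def
    proof (rule order_trans[OF integral_norm_bound integral_mono])
      show "integrable (cube_measure n) (\<lambda>v. norm (indicator (cube a b n) v *\<^sub>R (K s n v * \<rho> (s / of_real (growth n v)))))"
        using K_rho_integrable unfolding set_integrable_def by (rule integrable_norm)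
      show "integrable (cube_measure n) (\<lambda>v. indicator (cube a b n) v *\<^sub>R (1 / Re s * (norm (K s n v) * growth n v * ruin_avg (Re s / growth n v))))"
        using set_integrable_mult_right[OF majorant_integrable[OF unit_valued_ruin_avg, of n], of "1 / Re s"]
        by (simp add: set_integrable_def)
      fix v
      show "norm (indicator (cube a b n) v *\<^sub>R (K s n v * \<rho> (s / of_real (growth n v)))) \<le>
          indicator (cube a b n) v *\<^sub>R (1 / Re s * (norm (K s n v) * growth n v * ruin_avg (Re s / growth n v)))"
      proof (cases "v \<in> cube a b n")
        case True
        then have v: "v \<in> {1..n} \<rightarrow> {a..b}" by (simp add: PiE_iff)
        have "norm (\<rho> (s / of_real (growth n v))) \<le> 1 / Re s * (growth n v * ruin_avg (Re s / growth n v))"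
          using norm_rho_le_ruin_avg[OF scaled_pos(1)[OF v]] scaled_pos(2,3)[OF v] by (simp add: mult.commute)
        then have "norm (K s n v) * norm (\<rho> (s / of_real (growth n v))) \<le>
            norm (K s n v) * (1 / Re s * (growth n v * ruin_avg (Re s / growth n v)))"
          by (rule mult_left_mono) simp
        then show ?thesis using True by (simp add: norm_mult mult_ac)
      qed simp
    qed
    also have "\<dots> = 1 / Re s * (LINT v:cube a b n|cube_measure n. norm (K s n v) * growth n v * ruin_avg (Re s / growth n v))"
      by (rule set_integral_mult_right)
    also have "\<dots> \<le> 1 / Re s * ((\<Prod>i<n. corr i) * (averaging ^^ n) ruin_avg (Re s))"
      using s by (intro mult_left_mono majorant_le unit_valued_ruin_avg) auto
    also have "\<dots> \<le> 1 / Re s * (?E * (averaging ^^ n) ruin_avg (Re s))"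
      using s unit_valued_funpow[OF unit_valued_ruin_avg, of n]
      by (intro mult_left_mono mult_right_mono prod_corr_le) (auto simp: unit_valued_def)
    finally show "norm (rho_term n) \<le> 1 / Re s * (?E * (averaging ^^ n) ruin_avg (Re s))" .
  qed
  show "(\<lambda>n. 1 / Re s * (?E * (averaging ^^ n) ruin_avg (Re s))) \<longlonglongrightarrow> 0"
    using averaging_ruin_LIMSEQ[OF s] by (intro tendsto_mult_right_zero)
qed

text \<open>\<open>L\<close> is handled as the difference of \<open>\<rho>\<close> and the kernel
  integral in the functional equation. Both have simple bounds, so the complex logarithm needs no
  estimate.\<close>

lemma K_source_integrable:
  "set_integrable (cube_measure n) (cube a b n) (\<lambda>v. K s n v * L (s / of_real (growth n v)))"
  and rho_term_Suc: "rho_term (Suc n) = rho_term n - source_term n"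
proof -
  let ?z = "\<lambda>v. s / of_real (growth n v)"
  let ?h = "\<lambda>v. LBINT w:{a..b}. kernel_k \<phi> \<mu> a b (?z v) w * \<rho> (?z v / of_real (1 + w))"
  have eq: "L (?z v) = \<rho> (?z v) - ?h v" if "v \<in> {1..n} \<rightarrow> {a..b}" for v
    using rho_functional_equation[OF scaled_pos(1)[OF that] scaled_pos(4)[OF that]] by simp
  have inth: "set_integrable (cube_measure n) (cube a b n) (\<lambda>v. K s n v * ?h v)"
  proof (rule cube_integrable_bounded)
    show "(\<lambda>v. K s n v * ?h v) \<in> borel_measurable (cube_measure n)"
      unfolding set_lebesgue_integral_def by measurable
    fix v assume v: "v \<in> {1..n} \<rightarrow> {a..b}"
    have "norm (?h v) \<le> (corr n / (b - a) * ((1 + b) ^ Suc n / Re s)) * (b - a)"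
    proof (rule norm_set_integral_le)
      fix w assume w: "w \<in> {a..b}"
      have up: "v(Suc n := w) \<in> {1..Suc n} \<rightarrow> {a..b}" by (rule Pi_upd_Suc[OF v w])
      have z: "?z v / of_real (1 + w) = s / of_real (growth (Suc n) (v(Suc n := w)))"
        by (simp add: growth_Suc)
      have "norm (\<rho> (?z v / of_real (1 + w))) \<le> growth (Suc n) (v(Suc n := w)) / Re s"
        unfolding z using norm_rho_le[OF scaled_pos(1)[OF up]] scaled_pos(3)[OF up] by simp
      also have "\<dots> \<le> (1 + b) ^ Suc n / Re s"
        using growth_bounds(2)[OF up] a_pos s by (intro divide_right_mono) auto
      finally show "norm (kernel_k \<phi> \<mu> a b (?z v) w * \<rho> (?z v / of_real (1 + w))) \<le>
          corr n / (b - a) * ((1 + b) ^ Suc n / Re s)"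
        unfolding norm_mult using norm_kernel_le_const[OF v w] corr_nonneg[of n] a_less_b
        by (intro mult_mono) auto
    qed (use a_less_b a_pos s corr_nonneg in auto)
    then show "norm (K s n v * ?h v) \<le> (\<Prod>i<n. corr i / (b - a)) * ((corr n / (b - a) * ((1 + b) ^ Suc n / Re s)) * (b - a))"
      unfolding norm_mult using norm_K_le[OF v] prod_corr_nonneg by (intro mult_mono) auto
  qed
  have cong: "indicator (cube a b n) v *\<^sub>R (K s n v * L (?z v)) =
      indicator (cube a b n) v *\<^sub>R (K s n v * \<rho> (?z v) - K s n v * ?h v)" for v
  proof (cases "v \<in> cube a b n")
    case True
    then have v: "v \<in> {1..n} \<rightarrow> {a..b}" by (simp add: PiE_iff)
    show ?thesis unfolding eq[OF v] by (simp add: right_diff_distrib)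
  qed simp
  show "set_integrable (cube_measure n) (cube a b n) (\<lambda>v. K s n v * L (?z v))"
    using set_integral_diff(1)[OF K_rho_integrable inth] unfolding set_integrable_def cong .
  have "source_term n = (LINT v:cube a b n|cube_measure n. K s n v * \<rho> (?z v) - K s n v * ?h v)"
    unfolding cube_integral_def set_lebesgue_integral_def[where f="\<lambda>v. K s n v * L (?z v)"] cong
    by (simp only: set_lebesgue_integral_def)
  also have "\<dots> = rho_term n - (LINT v:cube a b n|cube_measure n. K s n v * ?h v)"
    unfolding cube_integral_def by (rule set_integral_diff(2)[OF K_rho_integrable inth])
  \<comment> \<open>Fubini read backwards: the inner integral becomes the coordinate n + 1.\<close>
  also have "(LINT v:cube a b n|cube_measure n. K s n v * ?h v) = rho_term (Suc n)"
    unfolding cube_integral_def cube_integral_Suc[OF K_rho_integrable]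
    by (simp only: kernel_prod_Suc growth_Suc growth_upd kernel_prod_upd fun_upd_same
        set_integral_mult_right[symmetric] of_real_mult divide_divide_eq_left mult.assoc)
  finally show "rho_term (Suc n) = rho_term n - source_term n" by simp
qed

lemma source_term_sums: "source_term sums \<rho> s"
proof -
  have "(\<Sum>i<n. source_term i) = \<rho> s - rho_term n" for n
    by (induction n) (simp_all add: rho_term_Suc cube_integral_0)
  moreover have "(\<lambda>n. \<rho> s - rho_term n) \<longlonglongrightarrow> \<rho> s - 0"
    by (intro tendsto_intros rho_term_LIMSEQ)
  ultimately show ?thesis by (simp add: sums_def)
qed

end

end

section \<open>The value at the gain rate\<close>

context dual_risk_model
begin

lemma pole_free_mu: "pole_free \<mu> a b (of_real \<mu>)"
  unfolding pole_free_def
proof (intro allI impI ballI)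
  fix j :: nat and v assume j: "1 \<le> j" and v: "v \<in> {1..j} \<rightarrow> {a..b}"
  have "1 < (1 + a) ^ j"
    using j a_pos by (intro one_less_power) auto
  then have "1 < growth j v"
    using growth_bounds(1)[OF v] a_pos by simp
  then show "complex_of_real \<mu> \<noteq> of_real (\<mu> * growth j v)"
    using mu_pos by (simp only: of_real_eq_iff) simp
qed

definition numerator_term :: "nat \<Rightarrow> (nat \<Rightarrow> real) \<Rightarrow> complex" where
  "numerator_term j v = K (of_real \<mu>) j v *
    ((1 - \<phi> (of_real (\<mu> / growth j v))) / of_real (\<mu> / growth j v))"

definition log_ratio :: "nat \<Rightarrow> (nat \<Rightarrow> real) \<Rightarrow> real" where
  "log_ratio j v = ln (((1 + b) * growth j v - 1) / ((1 + a) * growth j v - 1))"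

definition denominator_term :: "nat \<Rightarrow> (nat \<Rightarrow> real) \<Rightarrow> complex" where
  "denominator_term j v = K (of_real \<mu>) j v * \<phi> (of_real (\<mu> / growth j v)) * of_real (log_ratio j v)"

text \<open>The upper bound is ln y \<le> y - 1 together with (1 + a) g - 1 \<ge> a g for a growth
  factor g \<ge> 1; it does not depend on j.\<close>

lemma log_ratio_bounds:
  assumes v: "v \<in> {1..j} \<rightarrow> {a..b}"
  shows "0 < (1 + a) * growth j v - 1" "0 < (1 + b) * growth j v - 1" "0 \<le> log_ratio j v" "log_ratio j v \<le> (b - a) / a"
proof -
  have g: "1 \<le> growth j v" by (rule growth_ge_1[OF v a_pos])
  have A: "a * growth j v \<le> (1 + a) * growth j v - 1" using g by (simp add: algebra_simps)
  moreover have "0 < a * growth j v" using g a_pos by simp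
  ultimately show A0: "0 < (1 + a) * growth j v - 1" by linarith
  have le: "(1 + a) * growth j v - 1 \<le> (1 + b) * growth j v - 1"
    using g a_less_b by (simp add: mult_right_mono)
  then show B0: "0 < (1 + b) * growth j v - 1" using A0 by linarith
  show "0 \<le> log_ratio j v"
    unfolding log_ratio_def using le A0 by (intro ln_ge_zero) simp
  have "log_ratio j v \<le> ((1 + b) * growth j v - 1) / ((1 + a) * growth j v - 1) - 1"
    unfolding log_ratio_def using A0 B0 by (intro ln_le_minus_one) simp
  also have "\<dots> = (b - a) * growth j v / ((1 + a) * growth j v - 1)"
    using A0 by (simp add: divide_simps) (simp add: algebra_simps)
  also have "\<dots> \<le> (b - a) * growth j v / (a * growth j v)"
    using A g a_pos a_less_b A0 by (intro divide_left_mono) auto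
  also have "\<dots> = (b - a) / a" using g by simp
  finally show "log_ratio j v \<le> (b - a) / a" .
qed

lemma source_L_mu:
  assumes v: "v \<in> {1..j} \<rightarrow> {a..b}"
  shows "L (of_real \<mu> / of_real (growth j v)) =
    (1 - \<phi> (of_real (\<mu> / growth j v))) / of_real (\<mu> / growth j v) -
    \<rho> (of_real \<mu>) / of_real (b - a) * (\<phi> (of_real (\<mu> / growth j v)) * of_real (log_ratio j v))"
proof -
  have g: "1 \<le> growth j v" by (rule growth_ge_1[OF v a_pos])
  have "(of_real ((1 + b) * \<mu>) - of_real (\<mu> / growth j v)) / (of_real ((1 + a) * \<mu>) - of_real (\<mu> / growth j v)) =
      complex_of_real (((1 + b) * \<mu> - \<mu> / growth j v) / ((1 + a) * \<mu> - \<mu> / growth j v))"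
    by simp
  also have "((1 + b) * \<mu> - \<mu> / growth j v) / ((1 + a) * \<mu> - \<mu> / growth j v) =
      ((1 + b) * growth j v - 1) / ((1 + a) * growth j v - 1)"
  proof -
    \<comment> \<open>The factor mu/pi_j is common to numerator and denominator. The quotient is
      then a positive real, on which the complex logarithm is the real one.\<close>
    have "(1 + c) * \<mu> - \<mu> / growth j v = ((1 + c) * growth j v - 1) * (\<mu> / growth j v)" for c
      using g by (simp add: field_simps)
    then show ?thesis using g mu_pos by simp
  qed
  finally have "ln ((of_real ((1 + b) * \<mu>) - of_real (\<mu> / growth j v)) / (of_real ((1 + a) * \<mu>) - of_real (\<mu> / growth j v))) =
      complex_of_real (log_ratio j v)"
    using log_ratio_bounds[OF v] by (simp only: log_ratio_def Ln_of_real divide_pos_pos)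
  then show ?thesis
    unfolding source_L_def of_real_divide[symmetric] by (simp add: mult_ac)
qed

text \<open>At s = mu every kernel denominator is positive, as mu/pi_j \<le> mu < mu (1 + v). This
  sign keeps the denominator of the final formula away from 0.\<close>

lemma kernel_prod_mu:
  assumes "v \<in> {1..j} \<rightarrow> {a..b}"
  shows "\<exists>r\<ge>0. K (of_real \<mu>) j v = of_real r"
  using assms
proof (induction j)
  case (Suc j)
  then have v: "v \<in> {1..j} \<rightarrow> {a..b}" "v (Suc j) \<in> {a..b}" by (auto simp: Pi_iff)
  from Suc.IH[OF v(1)] obtain r where r: "0 \<le> r" "K (of_real \<mu>) j v = of_real r" by blast
  have g: "1 \<le> growth j v" by (rule growth_ge_1[OF v(1) a_pos])
  define q where "q = \<mu> / growth j v"
  have q: "0 < q" "q \<le> \<mu>" using g mu_pos by (auto simp: q_def field_simps)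
  have "kernel_k \<phi> \<mu> a b (of_real q) (v (Suc j)) =
      of_real (phi_real q / (b - a) * (\<mu> / (\<mu> * (1 + v (Suc j)) - q)))"
    unfolding kernel_k_def by (simp add: phi_of_real_eq[OF q(1)])
  moreover have "0 \<le> phi_real q / (b - a) * (\<mu> / (\<mu> * (1 + v (Suc j)) - q))"
  proof -
    have "\<mu> * 1 \<le> \<mu> * (1 + v (Suc j))" using v(2) a_pos mu_pos by (intro mult_left_mono) auto
    then have "q \<le> \<mu> * (1 + v (Suc j))" using q(2) by linarith
    then show ?thesis
      using mu_pos phi_real_nonneg[OF q(1)] a_less_b by (intro mult_nonneg_nonneg divide_nonneg_nonneg) auto
  qed
  ultimately show ?case
    unfolding kernel_prod_Suc r(2) of_real_divide[symmetric] q_def[symmetric]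
    using r(1) by (intro exI[of _ "r * (phi_real q / (b - a) * (\<mu> / (\<mu> * (1 + v (Suc j)) - q)))"] conjI)
      (simp_all only: of_real_mult mult_nonneg_nonneg)
qed (auto intro: exI[of _ 1])

lemma denominator_term_measurable: "denominator_term j \<in> borel_measurable (cube_measure j)"
  unfolding denominator_term_def[abs_def] log_ratio_def by measurable

text \<open>The factor pi_j/(1+a)^j \<ge> 1 is inserted so that the weighted majorant applies,
  leaving a geometrically decaying constant.\<close>

lemma norm_denominator_term_le:
  assumes v: "v \<in> {1..j} \<rightarrow> {a..b}"
  shows "norm (denominator_term j v) \<le> norm (K (of_real \<mu>) j v) * growth j v * ((b - a) / a / (1 + a) ^ j)"
proof -
  have g: "1 \<le> growth j v" by (rule growth_ge_1[OF v a_pos])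
  have pos: "0 < \<mu> / growth j v" using g mu_pos by simp
  have "norm (denominator_term j v) = norm (K (of_real \<mu>) j v) * (phi_real (\<mu> / growth j v) * log_ratio j v)"
    unfolding denominator_term_def norm_mult phi_of_real_eq[OF pos] norm_of_real
    using log_ratio_bounds(3)[OF v] phi_real_nonneg[OF pos] by simp
  also have "\<dots> \<le> norm (K (of_real \<mu>) j v) * (1 * ((b - a) / a))"
    using log_ratio_bounds[OF v] phi_real_le_1[OF pos] by (intro mult_left_mono mult_mono) auto
  also have "\<dots> \<le> norm (K (of_real \<mu>) j v) * (growth j v / (1 + a) ^ j * ((b - a) / a))"
    using growth_bounds(1)[OF v] a_pos a_less_b
    by (intro mult_left_mono mult_right_mono) (auto simp: divide_simps)
  finally show ?thesis by (simp add: mult_ac)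
qed

lemma Re_denominator_term_nonneg:
  assumes v: "v \<in> {1..j} \<rightarrow> {a..b}"
  shows "0 \<le> Re (denominator_term j v)"
proof -
  obtain r where r: "0 \<le> r" "K (of_real \<mu>) j v = of_real r" using kernel_prod_mu[OF v] by blast
  have pos: "0 < \<mu> / growth j v" using growth_ge_1[OF v a_pos] mu_pos by simp
  have "denominator_term j v = of_real (r * phi_real (\<mu> / growth j v) * log_ratio j v)"
    unfolding denominator_term_def r(2) phi_of_real_eq[OF pos] by simp
  then show ?thesis
    using r(1) phi_real_nonneg[OF pos] log_ratio_bounds(3)[OF v] by simp
qed

text \<open>Uses the majorant with g = 1, whose iterated averages are at most 1; summability is then
  comparison with ratio 1/(1+a).\<close>

lemma denominator_term_integrable: "cube_integrable a b j (denominator_term j)"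
  and denominator_term_summable: "summable (\<lambda>j. cube_integral a b j (denominator_term j))"
  and Re_denominator_term_integral: "0 \<le> Re (cube_integral a b j (denominator_term j))"
proof -
  have mu: "0 < Re (of_real \<mu>)" using mu_pos by simp
  note pf = pole_free_mu
  let ?q = "\<lambda>j. (b - a) / a / (1 + a) ^ j"
  let ?m = "\<lambda>j v. norm (K (of_real \<mu>) j v) * growth j v"
  have mi: "set_integrable (cube_measure j) (cube a b j) (?m j)" for j
    using majorant_integrable[OF mu pf unit_valued_one, of j] by simp
  have mi': "set_integrable (cube_measure j) (cube a b j) (\<lambda>v. ?m j v * ?q j)" for j
    using mi by simp
  have le: "norm (indicator (cube a b j) v *\<^sub>R denominator_term j v) \<le> indicator (cube a b j) v *\<^sub>R (?m j v * ?q j)" for j v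
    using norm_denominator_term_le[of v j] by (auto simp: indicator_def PiE_iff Pi_iff)
  have int: "set_integrable (cube_measure j) (cube a b j) (denominator_term j)" for j
    unfolding set_integrable_def
  proof (rule Bochner_Integration.integrable_bound[OF mi'[of j, unfolded set_integrable_def]])
    show "(\<lambda>v. indicator (cube a b j) v *\<^sub>R denominator_term j v) \<in> borel_measurable (cube_measure j)"
      using denominator_term_measurable[of j] by (intro borel_measurable_scaleR borel_measurable_indicator cube_sets)
    show "AE v in cube_measure j. norm (indicator (cube a b j) v *\<^sub>R denominator_term j v) \<le>
        norm (indicator (cube a b j) v *\<^sub>R (?m j v * ?q j))"
      by (rule AE_I2, rule order_trans[OF le]) (simp only: real_norm_def abs_ge_self)
  qed
  then show "cube_integrable a b j (denominator_term j)"
    by (simp add: cube_integrable_def)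
  let ?E = "exp (norm (of_real \<mu> :: complex) / pole_dist (of_real \<mu>) * (1 + a) / a)"
  have bnd: "norm (cube_integral a b j (denominator_term j)) \<le> (?E * ((b - a) / a)) * (1 / (1 + a)) ^ j" for j
  proof -
    have "norm (cube_integral a b j (denominator_term j)) \<le> (LINT v:cube a b j|cube_measure j. ?m j v * ?q j)"
      unfolding cube_integral_def set_lebesgue_integral_def
      using int[of j] mi'[of j] le[of j] unfolding set_integrable_def
      by (intro order_trans[OF integral_norm_bound integral_mono] integrable_norm)
    also have "\<dots> = (LINT v:cube a b j|cube_measure j. ?m j v) * ?q j"
      by (rule set_integral_mult_left)
    also have "(LINT v:cube a b j|cube_measure j. ?m j v) \<le> ?E"
    proof -
      have "(LINT v:cube a b j|cube_measure j. ?m j v) \<le> (\<Prod>i<j. corr (of_real \<mu>) i) * damping j \<mu>"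
        using majorant_le[OF mu pf unit_valued_one, of j] by (simp add: damping_def)
      also have "\<dots> \<le> ?E * 1"
        using damping_bounds[OF mu_pos] prod_corr_le[OF mu pf] by (intro mult_mono) auto
      finally show ?thesis by simp
    qed
    then have "(LINT v:cube a b j|cube_measure j. ?m j v) * ?q j \<le> ?E * ?q j"
      using a_pos a_less_b by (intro mult_right_mono) auto
    finally show ?thesis by (simp add: power_one_over mult_ac)
  qed
  show "summable (\<lambda>j. cube_integral a b j (denominator_term j))"
    by (rule summable_comparison_test'[OF _ bnd]) (use a_pos in \<open>auto intro!: summable_mult summable_geometric\<close>)
  show "0 \<le> Re (cube_integral a b j (denominator_term j))"
  proof -
    have "Re (cube_integral a b j (denominator_term j)) =
        (\<integral>v. Re (indicator (cube a b j) v *\<^sub>R denominator_term j v) \<partial>cube_measure j)"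
      unfolding cube_integral_def set_lebesgue_integral_def
      using int[of j] unfolding set_integrable_def by (rule integral_Re[symmetric])
    also have "\<dots> \<ge> 0"
      using Re_denominator_term_nonneg[of _ j]
      by (intro integral_nonneg_AE AE_I2) (auto simp: indicator_def PiE_iff Pi_iff)
    finally show ?thesis .
  qed
qed

text \<open>Obtained by solving the formula for \<open>L\<close> at mu/pi_j, so integrability and
  summability carry over from the source terms and the denominator terms.\<close>

lemma numerator_term_integrable: "cube_integrable a b j (numerator_term j)"
  and numerator_term_integral: "cube_integral a b j (numerator_term j) =
    cube_integral a b j (\<lambda>v. K (of_real \<mu>) j v * L (of_real \<mu> / of_real (growth j v))) +
    \<rho> (of_real \<mu>) / of_real (b - a) * cube_integral a b j (denominator_term j)"
proof -
  let ?c = "\<rho> (of_real \<mu>) / of_real (b - a)"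
  let ?S = "\<lambda>v. K (of_real \<mu>) j v * L (of_real \<mu> / of_real (growth j v))"
  have mu: "0 < Re (of_real \<mu>)" using mu_pos by simp
  have eq: "indicator (cube a b j) v *\<^sub>R numerator_term j v =
      indicator (cube a b j) v *\<^sub>R (?S v + ?c * denominator_term j v)" for v
  proof (cases "v \<in> cube a b j")
    case True
    then have v: "v \<in> {1..j} \<rightarrow> {a..b}" by (simp add: PiE_iff)
    show ?thesis
      unfolding source_L_mu[OF v] numerator_term_def denominator_term_def by (simp add: algebra_simps)
  qed simp
  have i1: "set_integrable (cube_measure j) (cube a b j) ?S"
    by (rule K_source_integrable[OF mu pole_free_mu])
  have i2: "set_integrable (cube_measure j) (cube a b j) (\<lambda>v. ?c * denominator_term j v)"
    using denominator_term_integrable[of j] unfolding cube_integrable_def by (rule set_integrable_mult_right)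
  show "cube_integrable a b j (numerator_term j)"
    using set_integral_add(1)[OF i1 i2] unfolding cube_integrable_def set_integrable_def eq .
  have "cube_integral a b j (numerator_term j) = (LINT v:cube a b j|cube_measure j. ?S v + ?c * denominator_term j v)"
    unfolding cube_integral_def set_lebesgue_integral_def eq ..
  also have "\<dots> = cube_integral a b j ?S + (LINT v:cube a b j|cube_measure j. ?c * denominator_term j v)"
    unfolding cube_integral_def by (rule set_integral_add(2)[OF i1 i2])
  finally show "cube_integral a b j (numerator_term j) = cube_integral a b j ?S + ?c * cube_integral a b j (denominator_term j)"
    unfolding cube_integral_def set_integral_mult_right .
qed

text \<open>Summing the previous identity gives \<open>\<rho>\<close> at mu times the denominator.
  Division is legitimate because the denominator terms have nonnegative real part, so the real part
  of the denominator is at least 1.\<close>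

lemma rho_mu:
  shows "summable (\<lambda>j. cube_integral a b j (numerator_term j))"
    and "1 + 1 / of_real (b - a) * (\<Sum>j. cube_integral a b j (denominator_term j)) \<noteq> 0" (is "?D \<noteq> 0")
    and "\<rho> (of_real \<mu>) = (\<Sum>j. cube_integral a b j (numerator_term j)) /
      (1 + 1 / of_real (b - a) * (\<Sum>j. cube_integral a b j (denominator_term j)))"
proof -
  have mu: "0 < Re (of_real \<mu>)" using mu_pos by simp
  let ?H = "\<Sum>j. cube_integral a b j (denominator_term j)"
  have H: "(\<lambda>j. cube_integral a b j (denominator_term j)) sums ?H"
    using denominator_term_summable by (rule summable_sums)
  have "(\<lambda>j. cube_integral a b j (numerator_term j)) sums (\<rho> (of_real \<mu>) + \<rho> (of_real \<mu>) / of_real (b - a) * ?H)"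
    unfolding numerator_term_integral
    by (intro sums_add sums_mult H source_term_sums[OF mu pole_free_mu])
  moreover have "\<rho> (of_real \<mu>) + \<rho> (of_real \<mu>) / of_real (b - a) * ?H = \<rho> (of_real \<mu>) * ?D"
    by (simp add: algebra_simps)
  ultimately have N: "(\<lambda>j. cube_integral a b j (numerator_term j)) sums (\<rho> (of_real \<mu>) * ?D)" by simp
  have "(\<lambda>j. Re (cube_integral a b j (denominator_term j))) sums Re ?H"
    using H by (rule sums_Re)
  then have "0 \<le> Re ?H"
    by (rule sums_le[OF Re_denominator_term_integral sums_zero])
  then have "0 \<le> Re (1 / of_real (b - a) * ?H)"
    using a_less_b by (simp add: Re_divide_of_real flip: of_real_diff)
  then have "Re 0 < Re ?D" by simp
  then show D: "?D \<noteq> 0" by (intro notI) (simp only: less_irrefl)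
  show "summable (\<lambda>j. cube_integral a b j (numerator_term j))"
    using N by (rule sums_summable)
  show "\<rho> (of_real \<mu>) = (\<Sum>j. cube_integral a b j (numerator_term j)) / ?D"
    unfolding sums_unique[OF N, symmetric] by (rule nonzero_mult_div_cancel_right[OF D, symmetric])
qed

lemma rho_series:
  assumes s: "0 < Re s" and pole: "pole_free \<mu> a b s"
  shows "cube_integrable a b j (\<lambda>v. K s j v * L (s / of_real (growth j v)))"
    and "summable (\<lambda>j. cube_integral a b (Suc j) (\<lambda>v. K s (Suc j) v * L (s / of_real (growth (Suc j) v))))"
    and "\<rho> s = L s + (\<Sum>j. cube_integral a b (Suc j) (\<lambda>v. K s (Suc j) v * L (s / of_real (growth (Suc j) v))))"
proof -
  show "cube_integrable a b j (\<lambda>v. K s j v * L (s / of_real (growth j v)))"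
    unfolding cube_integrable_def by (rule K_source_integrable[OF s pole])
  \<comment> \<open>The term of index 0 is \<open>L s\<close> itself; it is split off so that the
    sum starts at j = 1.\<close>
  have "(\<lambda>j. cube_integral a b (Suc j) (\<lambda>v. K s (Suc j) v * L (s / of_real (growth (Suc j) v)))) sums (\<rho> s - L s)"
    using source_term_sums[OF s pole] by (subst sums_Suc_iff) (simp add: cube_integral_0)
  then show "summable (\<lambda>j. cube_integral a b (Suc j) (\<lambda>v. K s (Suc j) v * L (s / of_real (growth (Suc j) v))))"
    and "\<rho> s = L s + (\<Sum>j. cube_integral a b (Suc j) (\<lambda>v. K s (Suc j) v * L (s / of_real (growth (Suc j) v))))"
    by (auto simp: sums_summable sums_unique[symmetric])
qed

end

theorem mainTheorem8:
  fixes M :: "'a measure"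
    and T C V :: "nat \<Rightarrow> 'a \<Rightarrow> real"
    and f :: "real \<Rightarrow> real" and \<mu> a b :: real
    and \<phi> \<rho> L :: "complex \<Rightarrow> complex"
    and K :: "complex \<Rightarrow> nat \<Rightarrow> (nat \<Rightarrow> real) \<Rightarrow> complex"
    and G H :: "nat \<Rightarrow> (nat \<Rightarrow> real) \<Rightarrow> complex"
  assumes model: "dual_risk_model M T C V f \<mu> a b"
    and phi: "\<phi> = laplace_stieltjes (density lborel f)"
    and rho: "\<rho> = laplace_transform (ruin_prob M T C V)"
    and L: "L = source_L \<phi> \<rho> \<mu> a b"
    and K: "K = kernel_prod \<phi> \<mu> a b"
    and G: "G = (\<lambda>j v. K (of_real \<mu>) j v *
              ((1 - \<phi> (of_real (\<mu> / growth j v))) / of_real (\<mu> / growth j v)))"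
    and H: "H = (\<lambda>j v. K (of_real \<mu>) j v * \<phi> (of_real (\<mu> / growth j v)) *
              of_real (ln (((1 + b) * growth j v - 1) / ((1 + a) * growth j v - 1))))"
  shows "(ln ((b + 1) / (a + 1)) < 1 \<longleftrightarrow> (b + 1) / (a + 1) < exp 1) \<and>
    (ln ((b + 1) / (a + 1)) < 1 \<longrightarrow>
      (\<forall>s. Re s > 0 \<and> pole_free \<mu> a b s \<longrightarrow>
         (\<forall>j. cube_integrable a b j (\<lambda>v. K s j v * L (s / of_real (growth j v)))) \<and>
         summable (\<lambda>j. cube_integral a b (Suc j)
           (\<lambda>v. K s (Suc j) v * L (s / of_real (growth (Suc j) v)))) \<and>
         \<rho> s = L s + (\<Sum>j. cube_integral a b (Suc j)
           (\<lambda>v. K s (Suc j) v * L (s / of_real (growth (Suc j) v))))) \<and>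
      (\<forall>j. cube_integrable a b j (G j)) \<and>
      (\<forall>j. cube_integrable a b j (H j)) \<and>
      summable (\<lambda>j. cube_integral a b j (G j)) \<and>
      summable (\<lambda>j. cube_integral a b j (H j)) \<and>
      1 + 1 / of_real (b - a) * (\<Sum>j. cube_integral a b j (H j)) \<noteq> 0 \<and>
      \<rho> (of_real \<mu>) =
        (\<Sum>j. cube_integral a b j (G j)) /
        (1 + 1 / of_real (b - a) * (\<Sum>j. cube_integral a b j (H j))))"
proof -
  interpret dual_risk_model M T C V f \<mu> a b by (rule model)
  have \<phi>_eq: "\<phi> = laplace_stieltjes law_T"
    by (simp add: phi law_T_def)
  have G_eq: "G = numerator_term"
    unfolding G K \<phi>_eq by (intro ext) (simp add: numerator_term_def)
  have H_eq: "H = denominator_term"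
    unfolding H K \<phi>_eq by (intro ext) (simp add: denominator_term_def log_ratio_def)
  have "0 < (b + 1) / (a + 1)"
    using a_pos a_less_b by simp
  then have iff: "ln ((b + 1) / (a + 1)) < 1 \<longleftrightarrow> (b + 1) / (a + 1) < exp 1"
    by (metis exp_gt_zero ln_exp ln_less_cancel_iff)
  show ?thesis
    unfolding G_eq H_eq L K rho \<phi>_eq
    by (intro conjI allI impI iff rho_series denominator_term_integrable denominator_term_summable
        numerator_term_integrable rho_mu; elim conjE; assumption)
qed

end
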